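(* Let $s_0=\sigma_0+it_0\in\mathbb{C}$ with $0<\sigma_0<3/2$ and $s=\sigma+it\in\mathbb{C}$ with $\sigma>1/2$, $\sigma_0+\sigma>1$, $s\ne1$ and $s_0+s\ne2$. Then, for $t\ge 2$, $$\zeta_2(s_0,s)=\sum_{m=1}^\infty\sum_{1\le n\le t}\frac{1}{m^{s_0}(m+n)^s}+\begin{cases}O(t^{1-\sigma_0-\sigma}) & (\sigma_0<1),\\ O(t^{-\sigma}\log t) & (\sigma_0=1),\\ O(t^{-\sigma}) & (\sigma_0>1).\end{cases}$$
   Context: The Euler double zeta-function is $\zeta_2(s_1,s_2)=\sum_{m=1}^\infty m^{-s_1}\sum_{n=1}^\infty (m+n)^{-s_2}$, absolutely convergent for $\Re s_2>1$, $\Re(s_1+s_2)>2$, and continued meromorphically to $\mathbb{C}^2$ (singularities on $s_2=1$ and $s_1+s_2=2,1,0,-2,-4,\dots$). Implied constants may depend on $s_0$ and $\sigma$ but not on $t$.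
   Formalization: The condition s_0+s≠2 is made uniform: |s_0+s-2|≥δ for an arbitrary δ>0, with implied constant depending also on δ; as stated the bound fails when σ_0+σ=2 and t_0≤-2, where t can approach the pole; in all other cases a suitable δ gives the original claim. *)

theory Defs
  imports "HOL-Complex_Analysis.Complex_Analysis"
begin

definition double_zeta_series :: "complex \<Rightarrow> complex \<Rightarrow> complex" where
  "double_zeta_series s1 s2 =
     (\<Sum>i. of_nat (Suc i) powr (- s1) * (\<Sum>j. of_nat (Suc i + Suc j) powr (- s2)))"

definition double_zeta_conv_region :: "(complex \<times> complex) set" where
  "double_zeta_conv_region = {(s1, s2). Re s2 > 1 \<and> Re (s1 + s2) > 2}"

text \<open>The hyperplanes \<open>s2 = 1\<close> and \<open>s1 + s2 = 2, 1, 0, -2, -4, \<dots>\<close>.\<close>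

definition double_zeta_sing :: "(complex \<times> complex) set" where
  "double_zeta_sing =
     {(s1, s2). s2 = 1 \<or> s1 + s2 = 2 \<or> s1 + s2 = 1 \<or> (\<exists>k::nat. s1 + s2 = - (2 * of_nat k))}"

text \<open>Holomorphy in two variables: total differentiability with a complex-linear derivative.\<close>

definition holomorphic2_on :: "(complex \<times> complex \<Rightarrow> complex) \<Rightarrow> (complex \<times> complex) set \<Rightarrow> bool"
  where
  "holomorphic2_on F U \<longleftrightarrow>
     (\<forall>z\<in>U. \<exists>A B. (F has_derivative (\<lambda>(h, k). A * h + B * k)) (at z))"

definition double_zeta_halfspaces :: "real \<Rightarrow> real \<Rightarrow> (complex \<times> complex) set" where
  "double_zeta_halfspaces a b = {(s1, s2). Re s2 > a \<and> Re (s1 + s2) > b}"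

definition is_double_zeta_continuation ::
    "(complex \<times> complex \<Rightarrow> complex) \<Rightarrow> (complex \<times> complex) set \<Rightarrow> bool" where
  "is_double_zeta_continuation F U \<longleftrightarrow>
     holomorphic2_on F (U - double_zeta_sing) \<and>
     (\<forall>(s1, s2) \<in> (U - double_zeta_sing) \<inter> double_zeta_conv_region.
        F (s1, s2) = double_zeta_series s1 s2)"

text \<open>
  The analytic continuation of the series, at any point of \<open>\<complex>\<^sup>2\<close> off the singular hyperplanes. The sets
  \<open>double_zeta_halfspaces a b\<close> exhaust \<open>\<complex>\<^sup>2\<close> as \<open>a, b \<rightarrow> -\<infinity>\<close>, are closed under binary intersection,
  all meet the region of convergence, and stay connected when the singular hyperplanes are removed.
  Hence continuations to any two of them agree on the common part, and the value below is that of
  the continuation to all of \<open>\<complex>\<^sup>2\<close>.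
\<close>

definition double_zeta :: "complex \<Rightarrow> complex \<Rightarrow> complex" where
  "double_zeta s1 s2 =
     (THE w. \<exists>a b F. (s1, s2) \<in> double_zeta_halfspaces a b \<and>
        is_double_zeta_continuation F (double_zeta_halfspaces a b) \<and> F (s1, s2) = w)"

end

theory Submission
  imports Defs
begin

text \<open>
  For \<open>Re s > 1\<close> write \<open>\<Sum>k>x. k powr - s = x powr (1 - s) / (s - 1) + R(x, s)\<close>; the Euler--Maclaurin
  remainder \<open>R\<close> continues to \<open>Re s > 0\<close> and decays like \<open>x powr - Re s\<close>. Hence
  \<open>\<zeta>(s1 + s2 - 1) / (s2 - 1) + \<Sum>m. m powr - s1 * R(m, s2)\<close> is the continuation of the double zeta
  function to \<open>Re s2 > 0\<close>, \<open>Re (s1 + s2) > 1\<close>. With \<open>N = \<lfloor>t\<rfloor>\<close> and \<open>v = s0 + s - 1\<close>, subtracting the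
  terms with \<open>n \<le> N\<close> leaves \<open>\<Sum>m. m powr - s0 * R(m + N, s) + G / (s - 1)\<close>, where
  \<open>G = N powr (1 - v) / (v - 1) + R(N, v) +
       \<Sum>m. (m powr - s0 - (m + N) powr - s0) * (m + N) powr (1 - s)\<close>.
  Everything is of the claimed size by absolute estimates, provided \<open>R(x, s) = O(x powr - \<sigma>)\<close>
  holds uniformly for \<open>x \<ge> t\<close>; this follows from the Kusmin--Landau inequality, since the phase
  \<open>t * ln x\<close> then varies by less than \<open>1\<close> over a unit interval.
\<close>

section \<open>The Euler--Maclaurin remainder of the zeta tail\<close>

text \<open>The obstacle is the size of \<open>s\<close>. Estimated term by term,
  \<open>em_rem x s\<close> is only O(|s| x^(-\<sigma>)), a factor t too much in the sum over
  \<open>em_rem (m + N) s\<close>, where nothing makes up for it. So the sum of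
  \<open>(x + j) powr (- s - 1)\<close> has to be bounded with its cancellation, which gains 1/t
  once x \<ge> t; cutting the inner sum at \<lfloor>t\<rfloor> puts every m + N in that range. All
  other pieces are divided by s - 1, of modulus at least t, and may lose one factor t each: |v| in
  the remainder at v, N in \<open>N powr (1 - v)\<close>, and m + N in the last series of G.

  The difference in that series is forced by convergence. Shifting the remainder leaves boundary
  terms \<open>m powr - s0 * m powr (1 - s)\<close> and
  \<open>m powr - s0 * (m + N) powr (1 - s)\<close>, both of size about m^(-Re v) with only Re v > 0
  known. Replacing the second by \<open>(m + N) powr - v\<close> makes the pair telescope to the
  first N terms of \<zeta>(v), which cancel against the continued \<zeta>(v); the difference is the
  price of the replacement.\<close>

lemma norm_of_real_powr:
  "0 < x \<Longrightarrow> norm (complex_of_real x powr z) = x powr Re z"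
  by (simp add: norm_powr_real_powr)

lemma has_vector_derivative_of_real_powr:
  assumes "0 < x"
  shows "((\<lambda>x. complex_of_real x powr z) has_vector_derivative z * complex_of_real x powr (z - 1))
           (at x within A)"
proof -
  have "((\<lambda>w. w powr z) has_field_derivative z * complex_of_real x powr (z - 1))
          (at (complex_of_real x))"
    using assms by (intro has_field_derivative_powr) (auto simp: complex_nonpos_Reals_iff)
  thus ?thesis
    by (rule has_vector_derivative_real_field)
qed

lemma norm_diff_le_of_vector_derivative_bound:
  fixes f :: "real \<Rightarrow> 'b::real_normed_vector"
  assumes "a \<le> b"
    and "\<And>x. a \<le> x \<Longrightarrow> x \<le> b \<Longrightarrow> (f has_vector_derivative f' x) (at x within {a..b})"
    and "\<And>x. a \<le> x \<Longrightarrow> x \<le> b \<Longrightarrow> norm (f' x) \<le> B"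
  shows "norm (f b - f a) \<le> B * (b - a)"
proof -
  have "norm (f b - f a) \<le> B * norm (b - a)"
  proof (rule differentiable_bound[of "{a..b}" f "\<lambda>x h. h *\<^sub>R f' x"])
    show "(f has_derivative (\<lambda>h. h *\<^sub>R f' x)) (at x within {a..b})" if "x \<in> {a..b}" for x
      using assms(2)[of x] that by (simp add: has_vector_derivative_def)
    show "onorm (\<lambda>h. h *\<^sub>R f' x) \<le> B" if "x \<in> {a..b}" for x
      using assms(3)[of x] that
      by (intro onorm_le) (simp, metis mult.commute mult_right_mono abs_ge_zero)
  qed (use assms(1) in auto)
  thus ?thesis using assms(1) by simp
qed

section \<open>Sums of real powers by comparison with a telescoping sum\<close>

text \<open>By the mean value theorem the decrease of \<open>y powr (- q)\<close> over the unit
  interval is \<open>q * z powr (- q - 1)\<close> at an inner point z, and this power is smallest at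
  the right end. In this shape the sums over shifts collapse.\<close>

lemma powr_minus_le_telescope:
  fixes x q :: real
  assumes "0 < x" "0 < q"
  shows "(x + 1) powr (- q - 1) \<le> (x powr (- q) - (x + 1) powr (- q)) / q"
proof -
  have "\<exists>z. x < z \<and> z < x + 1 \<and>
          (x + 1) powr (- q) - x powr (- q) = (x + 1 - x) * (- q * z powr (- q - 1))"
    by (rule MVT2) (use assms in \<open>auto intro!: derivative_eq_intros\<close>)
  then obtain z where z: "x < z" "z < x + 1"
      "(x + 1) powr (- q) - x powr (- q) = - q * z powr (- q - 1)"
    by auto
  have "(x + 1) powr (- q - 1) \<le> z powr (- q - 1)"
    using z assms by (intro powr_mono2') auto
  moreover have "(x powr (- q) - (x + 1) powr (- q)) / q = z powr (- q - 1)"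
    using z(3) assms by (simp add: field_simps)
  ultimately show ?thesis by simp
qed

lemma sum_powr_shift_le:
  fixes x q :: real
  assumes "0 < x" "0 < q"
  shows "(\<Sum>j<L. (x + real (Suc j)) powr (- q - 1)) \<le> x powr (- q) / q"
proof -
  have "(\<Sum>j<L. (x + real (Suc j)) powr (- q - 1))
          \<le> (\<Sum>j<L. ((x + real j) powr (- q) - (x + real (Suc j)) powr (- q)) / q)"
  proof (rule sum_mono)
    fix j
    show "(x + real (Suc j)) powr (- q - 1)
            \<le> ((x + real j) powr (- q) - (x + real (Suc j)) powr (- q)) / q"
      using powr_minus_le_telescope[of "x + real j" q] assms by (simp add: add_ac)
  qed
  also have "\<dots> = (x powr (- q) - (x + real L) powr (- q)) / q"
    using sum_lessThan_telescope'[of "\<lambda>j. (x + real j) powr (- q)" L]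
    by (simp add: sum_divide_distrib [symmetric] del: of_nat_Suc)
  also have "\<dots> \<le> x powr (- q) / q"
    using assms by (intro divide_right_mono) auto
  finally show ?thesis .
qed

lemma summable_powr_shift:
  fixes x q :: real
  assumes "0 < x" "0 < q"
  shows "summable (\<lambda>j. (x + real j) powr (- q - 1))"
proof -
  have "summable (\<lambda>j. (x + real (Suc j)) powr (- q - 1))"
    by (rule summableI_nonneg_bounded[where x = "x powr (- q) / q"])
       (use sum_powr_shift_le[OF assms] in auto)
  thus ?thesis by (subst (asm) summable_Suc_iff)
qed

lemma suminf_powr_shift_le:
  fixes x q :: real
  assumes "1 \<le> x" "0 < q"
  shows "(\<Sum>j. (x + real j) powr (- q - 1)) \<le> (1 + 1 / q) * x powr (- q)"
proof -
  have sm: "summable (\<lambda>j. (x + real j) powr (- q - 1))"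
    using assms by (intro summable_powr_shift) auto
  have "(\<Sum>j. (x + real (Suc j)) powr (- q - 1)) \<le> x powr (- q) / q"
    using summable_ignore_initial_segment[OF sm, of 1] assms
    by (intro suminf_le_const sum_powr_shift_le) (auto simp: add_ac)
  moreover have "x powr (- q - 1) \<le> x powr (- q)"
    using assms by (intro powr_mono) auto
  ultimately show ?thesis
    using suminf_split_head[OF sm] by (simp add: algebra_simps)
qed

text \<open>\<open>em_term x s\<close> is \<open>(x + 1) powr - s\<close> minus the integral of \<open>y powr - s\<close> over \<open>[x, x + 1]\<close>.\<close>

definition em_term :: "real \<Rightarrow> complex \<Rightarrow> complex" where
  "em_term x s = of_real (x + 1) powr (- s) - (of_real x powr (1 - s) - of_real (x + 1) powr (1 - s)) / (s - 1)"

text \<open>For x > 0 and Re s > 0 this is the Hurwitz zeta value at s with offset x + 1, less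
  \<open>x powr (1 - s) / (s - 1)\<close>. At s = 1 the division by zero makes the terms
  meaningless, hence the side condition \<open>s \<noteq> 1\<close>.\<close>

definition em_rem :: "real \<Rightarrow> complex \<Rightarrow> complex" where
  "em_rem x s = (\<Sum>j. em_term (x + real j) s)"

text \<open>Integration by parts turns \<open>em_term y s\<close> into - s times the integral of
  \<open>u * (y + u) powr (- s - 1)\<close> over [0, 1]. The sum over j is formed before norms are
  taken, so that \<open>B\<close> may come from cancellation among the terms.\<close>

lemma norm_sum_em_term_le:
  assumes "0 < x" "s \<noteq> 1"
    and B: "\<And>u. 0 \<le> u \<Longrightarrow> u \<le> 1 \<Longrightarrow> norm (\<Sum>j<L. complex_of_real (x + u + real j) powr (- s - 1)) \<le> B"
  shows "norm (\<Sum>j<L. em_term (x + real j) s) \<le> norm s * B"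
proof -
  txt \<open>\<open>\<psi> 1\<close> is the sum in question, and in \<open>\<psi>'\<close> the terms of order \<open>- s\<close> cancel.\<close>
  define \<psi> where "\<psi> = (\<lambda>u. \<Sum>j<L. of_real u * complex_of_real (u + (x + real j)) powr (- s)
     - (of_real (x + real j) powr (1 - s) - complex_of_real (u + (x + real j)) powr (1 - s)) / (s - 1))"
  have der: "(\<psi> has_vector_derivative
      (- s * of_real u * (\<Sum>j<L. complex_of_real (x + u + real j) powr (- s - 1)))) (at u within {0..1})"
    if u: "0 \<le> u" "u \<le> 1" for u
  proof -
    have D: "((\<lambda>u. complex_of_real (u + (x + real j)) powr z) has_vector_derivative
               z * complex_of_real (u + (x + real j)) powr (z - 1)) (at u within {0..1})" for z j
    proof -
      have "(((\<lambda>v. complex_of_real v powr z) \<circ> (\<lambda>u. u + (x + real j))) has_vector_derivative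
               1 *\<^sub>R (z * complex_of_real (u + (x + real j)) powr (z - 1))) (at u within {0..1})"
        using u assms
        by (intro vector_diff_chain_within has_vector_derivative_of_real_powr)
           (auto intro!: derivative_eq_intros)
      thus ?thesis by (simp add: o_def)
    qed
    have I: "(complex_of_real has_vector_derivative 1) (at u within {0..1})"
      using has_vector_derivative_of_real[OF DERIV_ident] by simp
    have "((\<lambda>u. of_real u * complex_of_real (u + (x + real j)) powr (- s)
     - (of_real (x + real j) powr (1 - s) - complex_of_real (u + (x + real j)) powr (1 - s)) / (s - 1))
       has_vector_derivative
        (of_real u * (- s * complex_of_real (u + (x + real j)) powr (- s - 1)) + 1 * complex_of_real (u + (x + real j)) powr (- s)
         - (0 - (1 - s) * complex_of_real (u + (x + real j)) powr (1 - s - 1)) / (s - 1))) (at u within {0..1})" for j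
      by (intro has_vector_derivative_diff has_vector_derivative_mult has_vector_derivative_divide
            has_vector_derivative_const D I)
    moreover have "of_real u * (- s * complex_of_real (u + (x + real j)) powr (- s - 1)) + 1 * complex_of_real (u + (x + real j)) powr (- s)
         - (0 - (1 - s) * complex_of_real (u + (x + real j)) powr (1 - s - 1)) / (s - 1)
         = - s * of_real u * complex_of_real (x + u + real j) powr (- s - 1)" for j
    proof -
      have "(0 - (1 - s) * w) / (s - 1) = w" for w
        using assms by (simp add: field_simps)
      thus ?thesis by (simp only:) (simp add: algebra_simps)
    qed
    ultimately show ?thesis
      unfolding \<psi>_def sum_distrib_left by (intro has_vector_derivative_sum) simp
  qed
  have "norm (\<psi> 1 - \<psi> 0) \<le> (norm s * B) * (1 - 0)"
  proof (rule norm_diff_le_of_vector_derivative_bound)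
    fix u :: real assume u: "0 \<le> u" "u \<le> 1"
    let ?S = "\<Sum>j<L. complex_of_real (x + u + real j) powr (- s - 1)"
    have "norm (- s * of_real u * ?S) = norm s * (u * norm ?S)"
      using u by (simp add: norm_mult)
    also have "\<dots> \<le> norm s * (1 * B)"
      using u B[OF u] by (intro mult_left_mono mult_mono) auto
    finally show "norm (- s * of_real u * ?S) \<le> norm s * B" by simp
  qed (use der in auto)
  moreover have "\<psi> 1 = (\<Sum>j<L. em_term (x + real j) s)"
    by (simp add: \<psi>_def em_term_def add_ac)
  moreover have "\<psi> 0 = 0" by (simp add: \<psi>_def)
  ultimately show ?thesis by simp
qed

lemma norm_em_term_le:
  assumes "0 < x" "s \<noteq> 1" "- 1 \<le> Re s"
  shows "norm (em_term x s) \<le> norm s * x powr (- Re s - 1)"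
proof -
  have "norm (\<Sum>j<(1::nat). em_term (x + real j) s) \<le> norm s * x powr (- Re s - 1)"
  proof (rule norm_sum_em_term_le)
    fix u :: real assume "0 \<le> u" "u \<le> 1"
    have "norm (complex_of_real (x + u) powr (- s - 1)) = (x + u) powr (- Re s - 1)"
      using assms \<open>0 \<le> u\<close> by (subst norm_of_real_powr) auto
    also have "\<dots> \<le> x powr (- Re s - 1)"
      using assms \<open>0 \<le> u\<close> by (intro powr_mono2') auto
    finally show "norm (\<Sum>j<(1::nat). complex_of_real (x + u + real j) powr (- s - 1)) \<le> x powr (- Re s - 1)"
      by simp
  qed (use assms in auto)
  thus ?thesis by simp
qed

lemma summable_em_term:
  assumes "0 < x" "s \<noteq> 1" "0 < Re s"
  shows "summable (\<lambda>j. em_term (x + real j) s)"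
proof (rule summable_comparison_test')
  show "summable (\<lambda>j. norm s * (x + real j) powr (- Re s - 1))"
    using assms by (intro summable_mult summable_powr_shift) auto
qed (use assms in \<open>auto intro!: norm_em_term_le\<close>)

text \<open>The termwise bound, with its factor |s|: enough for convergence and holomorphy, and
  wherever a division by s - 1 follows, but not uniform in the imaginary part.\<close>

lemma norm_em_rem_le:
  assumes "1 \<le> x" "s \<noteq> 1" "0 < Re s"
  shows "norm (em_rem x s) \<le> norm s * (1 + 1 / Re s) * x powr (- Re s)"
proof -
  have sm: "summable (\<lambda>j. norm s * (x + real j) powr (- Re s - 1))"
    using assms by (intro summable_mult summable_powr_shift) auto
  have "norm (em_rem x s) \<le> (\<Sum>j. norm s * (x + real j) powr (- Re s - 1))"
    unfolding em_rem_def using assms by (intro norm_suminf_le sm norm_em_term_le) auto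
  also have "\<dots> = norm s * (\<Sum>j. (x + real j) powr (- Re s - 1))"
    using assms by (intro suminf_mult summable_powr_shift) auto
  also have "\<dots> \<le> norm s * ((1 + 1 / Re s) * x powr (- Re s))"
    using assms by (intro mult_left_mono suminf_powr_shift_le) auto
  finally show ?thesis by (simp add: mult_ac)
qed

lemma sum_em_term_eq:
  assumes "s \<noteq> 1"
  shows "(\<Sum>j<L. em_term (x + real j) s) =
    (\<Sum>j<L. of_real (x + real (Suc j)) powr (- s)) - (of_real x powr (1 - s) - of_real (x + real L) powr (1 - s)) / (s - 1)"
proof (induction L)
  case (Suc L)
  show ?case unfolding sum.lessThan_Suc Suc
    by (simp add: em_term_def diff_divide_distrib add_ac)
qed auto

text \<open>Splitting the tail after L terms, in a form that survives where the tail itself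
  diverges: only the series of \<open>em_term\<close> is split, and that one converges for all Re s
  > 0. This is how the terms with n \<le> N are extracted from the continuation.\<close>

lemma em_rem_shift:
  assumes "0 < x" "s \<noteq> 1" "0 < Re s"
  shows "em_rem x s = (\<Sum>j<L. of_real (x + real (Suc j)) powr (- s))
     - (of_real x powr (1 - s) - of_real (x + real L) powr (1 - s)) / (s - 1) + em_rem (x + real L) s"
proof -
  have "em_rem x s = (\<Sum>j. em_term (x + real (j + L)) s) + (\<Sum>j<L. em_term (x + real j) s)"
    unfolding em_rem_def by (intro suminf_split_initial_segment summable_em_term assms)
  also have "(\<Sum>j. em_term (x + real (j + L)) s) = em_rem (x + real L) s"
    unfolding em_rem_def by (simp add: add_ac)
  finally show ?thesis
    unfolding sum_em_term_eq[OF assms(2)] by simp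
qed

lemma tendsto_of_real_powr_shift:
  assumes "Re z < 0"
  shows "(\<lambda>j. complex_of_real (x + real j) powr z) \<longlonglongrightarrow> 0"
proof (rule Lim_null_comparison)
  show "\<forall>\<^sub>F j in sequentially. norm (complex_of_real (x + real j) powr z) \<le> (x + real j) powr Re z"
    using eventually_gt_at_top[of "nat \<lceil>\<bar>x\<bar>\<rceil>"]
  proof eventually_elim
    case (elim j)
    hence "0 < x + real j" by linarith
    thus ?case using norm_of_real_powr[of "x + real j" z] by simp
  qed
  have "filterlim (\<lambda>j. x + real j) at_top sequentially"
    by (intro filterlim_tendsto_add_at_top[OF tendsto_const] filterlim_real_sequentially)
  thus "(\<lambda>j. (x + real j) powr Re z) \<longlonglongrightarrow> 0"
    by (rule tendsto_neg_powr[OF assms])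
qed

text \<open>The limit L \<rightarrow> \<infinity> of \<open>sum_em_term_eq\<close>, where the
  boundary power vanishes because of \<open>1 < Re s\<close>.\<close>

lemma sums_of_real_powr_shift:
  assumes "0 < x" "1 < Re s"
  shows "(\<lambda>j. of_real (x + real (Suc j)) powr (- s)) sums (of_real x powr (1 - s) / (s - 1) + em_rem x s)"
proof -
  have s: "s \<noteq> 1" using assms by auto
  have "(\<lambda>L. \<Sum>j<L. em_term (x + real j) s) \<longlonglongrightarrow> em_rem x s"
    unfolding em_rem_def using summable_em_term[of x s] assms s
    by (auto intro!: summable_LIMSEQ)
  moreover have "(\<lambda>L. (of_real x powr (1 - s) - complex_of_real (x + real L) powr (1 - s)) / (s - 1))
        \<longlonglongrightarrow> (of_real x powr (1 - s) - 0) / (s - 1)"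
    using assms s by (intro tendsto_intros tendsto_of_real_powr_shift) auto
  ultimately have "(\<lambda>L. (of_real x powr (1 - s) - complex_of_real (x + real L) powr (1 - s)) / (s - 1)
     + (\<Sum>j<L. em_term (x + real j) s)) \<longlonglongrightarrow> (of_real x powr (1 - s) - 0) / (s - 1) + em_rem x s"
    by (rule tendsto_add[rotated])
  thus ?thesis unfolding sums_def sum_em_term_eq[OF s] by simp
qed

section \<open>Kusmin--Landau estimates and the uniform remainder bound\<close>

text \<open>The imaginary part suffices: it is
  \<open>(1 + 1 / x) powr (- Re z) * sin \<alpha>\<close>, with \<alpha> the phase increment between
  x and x + 1. As t \<le> x forces \<alpha> \<le> 1, sin \<alpha> is at least \<alpha> / 2, and
  \<alpha> is at least t / (2x); the power is at least \<open>2 powr (- Re z)\<close> since x \<ge>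
  1.\<close>

lemma norm_one_minus_of_real_powr_ge:
  fixes x t :: real
  assumes "Im z = t" "0 < t" "t \<le> x" "1 \<le> x" "0 \<le> Re z"
  shows "2 powr (- Re z) * t / (4 * x) \<le> norm (1 - complex_of_real (1 + 1 / x) powr (- z))"
proof -
  define \<alpha> where "\<alpha> = t * ln (1 + 1 / x)"
  have x: "0 < x" using assms by linarith
  have "ln (1 + 1 / x) \<le> 1 / x"
    using x by (intro ln_add_one_self_le_self) auto
  hence "\<alpha> \<le> t * (1 / x)" unfolding \<alpha>_def using assms by (intro mult_left_mono) auto
  also have "\<dots> \<le> 1" using assms x by simp
  finally have a1: "\<alpha> \<le> 1" .
  \<comment> \<open>The lower bound ln y \<ge> 1 - 1/y; at y = 1 + 1/x its right side is 1 / (x +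
    1).\<close>
  have "1 - inverse (1 + 1 / x) \<le> ln (1 + 1 / x)"
    using ln_le_minus_one[of "inverse (1 + 1 / x)"] x by (simp add: ln_inverse add_pos_pos)
  moreover have "1 / (2 * x) \<le> 1 - inverse (1 + 1 / x)"
    using assms x by (simp add: field_simps)
  ultimately have "1 / (2 * x) \<le> ln (1 + 1 / x)" by linarith
  hence "t * (1 / (2 * x)) \<le> \<alpha>" unfolding \<alpha>_def using assms by (intro mult_left_mono) auto
  hence a2: "t / (2 * x) \<le> \<alpha>" by simp
  have a0: "0 < \<alpha>" using a2 assms x by (smt (verit) divide_pos_pos)
  have "\<alpha> / 2 \<le> sin \<alpha>"
  proof -
    have "\<bar>sin \<alpha> - \<alpha>\<bar> \<le> \<alpha> * \<alpha> / 2"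
      using Maclaurin_sin_bound[of \<alpha> 2] by (simp add: sin_coeff_def lessThan_nat_numeral lessThan_Suc power2_eq_square)
    moreover have "\<alpha> * \<alpha> \<le> \<alpha> * 1"
      using a0 a1 by (intro mult_left_mono) auto
    ultimately show ?thesis by linarith
  qed
  hence s: "t / (4 * x) \<le> sin \<alpha>" using a2 by simp
  have sn: "0 \<le> t / (4 * x)" using assms x by simp
  have "2 powr (- Re z) \<le> (1 + 1 / x) powr (- Re z)"
    using assms x by (intro powr_mono2') (auto simp: field_simps)
  hence "2 powr (- Re z) * (t / (4 * x)) \<le> (1 + 1 / x) powr (- Re z) * sin \<alpha>"
    using s sn by (intro mult_mono) auto
  also have "\<dots> = Im (1 - complex_of_real (1 + 1 / x) powr (- z))"
  proof -
    have p: "0 < 1 + 1 / x" using x by (simp add: add_pos_pos)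
    have "complex_of_real (1 + 1 / x) \<noteq> 0" using p unfolding of_real_eq_0_iff by simp
    hence "complex_of_real (1 + 1 / x) powr (- z) = exp (- z * of_real (ln (1 + 1 / x)))"
      using p unfolding powr_def by (simp add: Ln_of_real del: of_real_add of_real_divide)
    hence "Im (1 - complex_of_real (1 + 1 / x) powr (- z)) = exp (- Re z * ln (1 + 1 / x)) * sin \<alpha>"
      using assms by (simp add: Im_exp \<alpha>_def)
    thus ?thesis using p by (simp add: powr_def)
  qed
  also have "\<dots> \<le> norm (1 - complex_of_real (1 + 1 / x) powr (- z))"
    using abs_Im_le_cmod abs_le_D1 by blast
  finally show ?thesis by simp
qed

text \<open>The derivative in y of \<open>(1 + 1 / y) powr (- z)\<close> is z / y^2 times a power of
  modulus at most 1. The decay 1 / x^2 is what offsets the growth of the two reciprocals in an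
  increment of \<open>c\<close> below.\<close>

lemma norm_one_plus_inverse_powr_diff_le:
  fixes x :: real
  assumes "0 < x" "0 \<le> Re z"
  shows "norm (complex_of_real (1 + 1 / (x + 1)) powr (- z) - complex_of_real (1 + 1 / x) powr (- z))
           \<le> norm z / x\<^sup>2"
proof -
  have "norm (complex_of_real (1 + 1 / (x + 1)) powr (- z) - complex_of_real (1 + 1 / x) powr (- z))
      \<le> norm z / x\<^sup>2 * (x + 1 - x)"
  proof (rule norm_diff_le_of_vector_derivative_bound
      [where f = "\<lambda>y. complex_of_real (1 + 1 / y) powr (- z)" and
        f' = "\<lambda>y. (- (1 / y\<^sup>2)) *\<^sub>R (- z * complex_of_real (1 + 1 / y) powr (- z - 1))"])
    fix y assume y: "x \<le> y" "y \<le> x + 1"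
    have "(((\<lambda>v. complex_of_real v powr (- z)) \<circ> (\<lambda>y. 1 + 1 / y)) has_vector_derivative
             (- (1 / y\<^sup>2)) *\<^sub>R (- z * complex_of_real (1 + 1 / y) powr (- z - 1))) (at y within {x..x+1})"
      using assms y
      by (intro vector_diff_chain_within has_vector_derivative_of_real_powr)
         (auto intro!: derivative_eq_intros add_pos_pos simp: power2_eq_square
            has_real_derivative_iff_has_vector_derivative [symmetric])
    thus "((\<lambda>y. complex_of_real (1 + 1 / y) powr (- z)) has_vector_derivative
             (- (1 / y\<^sup>2)) *\<^sub>R (- z * complex_of_real (1 + 1 / y) powr (- z - 1))) (at y within {x..x+1})"
      by (simp add: o_def)
    have "norm (complex_of_real (1 + 1 / y) powr (- z - 1)) = (1 + 1 / y) powr (- Re z - 1)"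
      using assms y by (subst norm_of_real_powr) (auto intro: add_pos_pos)
    also have "\<dots> \<le> (1 + 1 / y) powr 0"
      using assms y by (intro powr_mono) auto
    finally have n1: "norm (complex_of_real (1 + 1 / y) powr (- z - 1)) \<le> 1"
      using assms y add_pos_pos[of 1 "1 / y"] by (simp split: if_splits)
    have "1 / y\<^sup>2 \<le> 1 / x\<^sup>2"
      using assms y by (intro divide_left_mono power_mono) auto
    hence "1 / y\<^sup>2 * (norm z * norm (complex_of_real (1 + 1 / y) powr (- z - 1))) \<le> 1 / x\<^sup>2 * (norm z * 1)"
      using n1 by (intro mult_mono mult_left_mono) auto
    thus "norm ((- (1 / y\<^sup>2)) *\<^sub>R (- z * complex_of_real (1 + 1 / y) powr (- z - 1))) \<le> norm z / x\<^sup>2"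
      by (simp add: norm_mult)
  qed (use assms in auto)
  thus ?thesis by simp
qed

text \<open>Kusmin--Landau: with \<open>c x = 1 / (1 - (1 + 1 / x) powr - z)\<close>, the product \<open>x powr - z * c x\<close> is an
  antidifference of \<open>x powr - z\<close> up to a term involving only the increments of \<open>c\<close>.\<close>

lemma norm_sum_of_real_powr_le:
  fixes q :: real
  assumes "0 < q"
  obtains C where "\<And>t x z L. Re z = q + 1 \<Longrightarrow> Im z = t \<Longrightarrow> 1 \<le> t \<Longrightarrow> t \<le> x \<Longrightarrow>
     norm (\<Sum>j<L. complex_of_real (x + real j) powr (- z)) \<le> C * x powr (- q) / t"
proof
  \<comment> \<open>Chosen so that the lower bound for the denominator of \<open>c y\<close> reads t
    / (K y) when Re z = q + 1.\<close>
  define K where "K = 4 * 2 powr (q + 1)"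
  have K: "0 < K" by (simp add: K_def)
  fix t x :: real and z :: complex and L :: nat
  assume z: "Re z = q + 1" "Im z = t" and t: "1 \<le> t" "t \<le> x"
  define c where "c = (\<lambda>y. 1 / (1 - complex_of_real (1 + 1 / y) powr (- z)))"
  define a where "a = (\<lambda>y. complex_of_real y powr (- z))"
  have lb: "t / (K * y) \<le> norm (1 - complex_of_real (1 + 1 / y) powr (- z))" if "x \<le> y" for y
  proof -
    have "t / (K * y) = 2 powr (- Re z) * t / (4 * y)"
      unfolding z(1) K_def powr_minus by (simp only: divide_inverse inverse_mult_distrib mult_ac)
    also have "\<dots> \<le> norm (1 - complex_of_real (1 + 1 / y) powr (- z))"
      using z t that assms by (intro norm_one_minus_of_real_powr_ge) auto
    finally show ?thesis .
  qed
  have ne: "1 - complex_of_real (1 + 1 / y) powr (- z) \<noteq> 0" if "x \<le> y" for y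
  proof -
    have "0 < t / (K * y)" using K t that by simp
    thus ?thesis using lb[OF that] by auto
  qed
  have cb: "norm (c y) \<le> K * y / t" if "x \<le> y" for y
  proof -
    have "1 / norm (1 - complex_of_real (1 + 1 / y) powr (- z)) \<le> 1 / (t / (K * y))"
      using K t that lb[OF that] ne[OF that] by (intro divide_left_mono) auto
    thus ?thesis by (simp add: c_def norm_divide)
  qed
  have na: "norm (a y) = y powr (- q - 1)" if "x \<le> y" for y
    using that t z unfolding a_def by (subst norm_of_real_powr) auto
  have ca: "norm (a y * c y) \<le> K / t * x powr (- q)" if "x \<le> y" for y
  proof -
    have "norm (a y * c y) \<le> y powr (- q - 1) * (K * y / t)"
      unfolding norm_mult na[OF that] using cb[OF that] by (intro mult_left_mono) auto
    also have "\<dots> = K / t * y powr (- q)"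
      using t that by (simp add: powr_diff field_simps)
    also have "\<dots> \<le> K / t * x powr (- q)"
      using t that K assms by (intro mult_left_mono powr_mono2') auto
    finally show ?thesis .
  qed
  \<comment> \<open>An increment of \<open>c\<close> is the difference of the denominators times
    \<open>c y * c (y + 1)\<close>. The 1 / y^2 of the difference offsets the size K y / t and K (y
    + 1) / t of these factors, and |z| \<le> (q + 2) t uses up one of the two t; the bound no longer
    depends on y.\<close>
  have cd: "norm (c y - c (y + 1)) \<le> 2 * K\<^sup>2 * (q + 2) / t" if "x \<le> y" for y
  proof -
    have "c y - c (y + 1) = - (complex_of_real (1 + 1 / (y + 1)) powr (- z) - complex_of_real (1 + 1 / y) powr (- z)) * c y * c (y + 1)"
      using ne[of y] ne[of "y + 1"] that unfolding c_def by (simp add: divide_simps)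
    hence "norm (c y - c (y + 1)) = norm (complex_of_real (1 + 1 / (y + 1)) powr (- z) - complex_of_real (1 + 1 / y) powr (- z)) * norm (c y) * norm (c (y + 1))"
      by (simp only: norm_mult norm_minus_cancel)
    also have "\<dots> \<le> norm z / y\<^sup>2 * (K * y / t) * (K * (y + 1) / t)"
      using t that z K assms
      by (intro mult_mono norm_one_plus_inverse_powr_diff_le cb) auto
    also have "\<dots> \<le> ((q + 2) * t) / y\<^sup>2 * (K * y / t) * (K * (2 * y) / t)"
    proof (intro mult_mono divide_right_mono)
      have "norm z \<le> \<bar>Re z\<bar> + \<bar>Im z\<bar>" by (rule cmod_le)
      also have "\<dots> = (q + 1) + t" using z t assms by simp
      also have "\<dots> \<le> (q + 1) * t + t" using t assms by (simp add: mult_le_cancel_left1)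
      finally show "norm z \<le> (q + 2) * t" by (simp add: algebra_simps)
    qed (use t that K assms in auto)
    also have "\<dots> = 2 * K\<^sup>2 * (q + 2) / t"
      using t that by (simp add: field_simps power2_eq_square)
    finally show ?thesis .
  qed
  \<comment> \<open>Summation by parts: \<open>c y\<close> is the factor for which
    \<open>(a y - a (y + 1)) * c y = a y\<close>.\<close>
  have step: "a y = a y * c y - a (y + 1) * c (y + 1) - a (y + 1) * (c y - c (y + 1))" if "x \<le> y" for y
  proof -
    have y: "0 < y" using that t by linarith
    have "a (y + 1) = a y * complex_of_real (1 + 1 / y) powr (- z)"
    proof -
      have "complex_of_real (y + 1) = of_real y * of_real (1 + 1 / y)"
        using y by (simp add: field_simps)
      thus ?thesis unfolding a_def using y
        by (subst powr_times_real [symmetric]) (auto intro: add_nonneg_nonneg)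
    qed
    hence "(a y - a (y + 1)) * c y = a y"
      unfolding c_def using ne[OF that] by (simp add: field_simps)
    thus ?thesis by (simp add: algebra_simps)
  qed
  have eq: "(\<Sum>j<L. a (x + real j)) = a x * c x - a (x + real L) * c (x + real L)
      - (\<Sum>j<L. a (x + real (Suc j)) * (c (x + real j) - c (x + real (Suc j))))"
  proof (induction L)
    case (Suc L)
    show ?case unfolding sum.lessThan_Suc Suc
      using step[of "x + real L"] by (simp add: algebra_simps)
  qed auto
  have "norm (\<Sum>j<L. a (x + real (Suc j)) * (c (x + real j) - c (x + real (Suc j))))
      \<le> (\<Sum>j<L. (x + real (Suc j)) powr (- q - 1) * (2 * K\<^sup>2 * (q + 2) / t))"
  proof (rule sum_norm_le)
    fix j
    show "norm (a (x + real (Suc j)) * (c (x + real j) - c (x + real (Suc j))))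
        \<le> (x + real (Suc j)) powr (- q - 1) * (2 * K\<^sup>2 * (q + 2) / t)"
    proof -
      have na': "norm (a (x + real (Suc j))) = (x + real (Suc j)) powr (- q - 1)"
        by (rule na) simp
      have "norm (c (x + real j) - c (x + real (Suc j))) \<le> 2 * K\<^sup>2 * (q + 2) / t"
        using cd[of "x + real j"] by (simp add: add_ac)
      thus ?thesis unfolding norm_mult na' by (intro mult_left_mono) auto
    qed
  qed
  also have "\<dots> \<le> x powr (- q) / q * (2 * K\<^sup>2 * (q + 2) / t)"
    unfolding sum_distrib_right [symmetric]
    using t assms by (intro mult_right_mono sum_powr_shift_le) auto
  finally have b3: "norm (\<Sum>j<L. a (x + real (Suc j)) * (c (x + real j) - c (x + real (Suc j))))
      \<le> x powr (- q) / q * (2 * K\<^sup>2 * (q + 2) / t)" .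
  have "norm (\<Sum>j<L. a (x + real j)) \<le> norm (a x * c x) + norm (a (x + real L) * c (x + real L))
      + norm (\<Sum>j<L. a (x + real (Suc j)) * (c (x + real j) - c (x + real (Suc j))))"
    unfolding eq by (intro order_trans[OF norm_triangle_ineq4] add_right_mono norm_triangle_ineq4)
  also have "\<dots> \<le> K / t * x powr (- q) + K / t * x powr (- q) + x powr (- q) / q * (2 * K\<^sup>2 * (q + 2) / t)"
    using ca[of x] ca[of "x + real L"] b3 by (intro add_mono) auto
  also have "\<dots> = (2 * K + 2 * K\<^sup>2 * (q + 2) / q) * x powr (- q) / t"
    using assms t by (simp add: field_simps)
  finally show "norm (\<Sum>j<L. complex_of_real (x + real j) powr (- z))
      \<le> (2 * K + 2 * K\<^sup>2 * (q + 2) / q) * x powr (- q) / t"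
    by (simp add: a_def)
qed

text \<open>The Kusmin--Landau bound at exponent s + 1 carries 1 / t, which cancels |s| \<le>
  (\<sigma> + 1) t. Shifting x by u keeps the argument at least t, and the bound for finite sums
  does not depend on L, so it passes to the limit.\<close>

lemma norm_em_rem_le_uniform:
  fixes \<sigma> :: real
  assumes "0 < \<sigma>"
  obtains C where "0 \<le> C" and "\<And>t x s. Re s = \<sigma> \<Longrightarrow> Im s = t \<Longrightarrow> 1 \<le> t \<Longrightarrow> t \<le> x \<Longrightarrow>
     norm (em_rem x s) \<le> C * x powr (- \<sigma>)"
proof -
  obtain C where C: "\<And>t x z L. Re z = \<sigma> + 1 \<Longrightarrow> Im z = t \<Longrightarrow> 1 \<le> t \<Longrightarrow> t \<le> x \<Longrightarrow>
     norm (\<Sum>j<L. complex_of_real (x + real j) powr (- z)) \<le> C * x powr (- \<sigma>) / t"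
    using norm_sum_of_real_powr_le[OF assms] by metis
  show ?thesis
  proof (rule that[of "(\<sigma> + 1) * \<bar>C\<bar>"])
    show "0 \<le> (\<sigma> + 1) * \<bar>C\<bar>" using assms by simp
    fix t x :: real and s :: complex
    assume s: "Re s = \<sigma>" "Im s = t" and t: "1 \<le> t" "t \<le> x"
    have s1: "s \<noteq> 1" using s t by auto
    have "norm (\<Sum>j<L. em_term (x + real j) s) \<le> (\<sigma> + 1) * \<bar>C\<bar> * x powr (- \<sigma>)" for L
    proof -
      have "norm (\<Sum>j<L. em_term (x + real j) s) \<le> norm s * (\<bar>C\<bar> * x powr (- \<sigma>) / t)"
      proof (rule norm_sum_em_term_le)
        fix u :: real assume u: "0 \<le> u" "u \<le> 1"
        have "norm (\<Sum>j<L. complex_of_real (x + u + real j) powr (- s - 1)) \<le> C * (x + u) powr (- \<sigma>) / t"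
          using C[of "s + 1" t "x + u" L] s t u by simp
        also have "\<dots> \<le> \<bar>C\<bar> * x powr (- \<sigma>) / t"
          using t u assms by (intro divide_right_mono mult_mono powr_mono2') auto
        finally show "norm (\<Sum>j<L. complex_of_real (x + u + real j) powr (- s - 1)) \<le> \<bar>C\<bar> * x powr (- \<sigma>) / t" .
      qed (use t s1 in auto)
      also have "\<dots> \<le> ((\<sigma> + 1) * t) * (\<bar>C\<bar> * x powr (- \<sigma>) / t)"
      proof (rule mult_right_mono)
        have "norm s \<le> \<bar>Re s\<bar> + \<bar>Im s\<bar>" by (rule cmod_le)
        also have "\<dots> = \<sigma> + t" using s t assms by simp
        also have "\<dots> \<le> \<sigma> * t + t" using t assms by (simp add: mult_le_cancel_left1)
        finally show "norm s \<le> (\<sigma> + 1) * t" by (simp add: algebra_simps)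
      qed (use t in auto)
      also have "\<dots> = (\<sigma> + 1) * \<bar>C\<bar> * x powr (- \<sigma>)" using t by simp
      finally show ?thesis .
    qed
    moreover have "(\<lambda>L. \<Sum>j<L. em_term (x + real j) s) \<longlonglongrightarrow> em_rem x s"
      unfolding em_rem_def using summable_em_term[of x s] assms s s1 t
      by (auto intro!: summable_LIMSEQ)
    ultimately show "norm (em_rem x s) \<le> (\<sigma> + 1) * \<bar>C\<bar> * x powr (- \<sigma>)"
      by (intro LIMSEQ_le_const2[OF tendsto_norm]) auto
  qed
qed

section \<open>Holomorphic functions of two variables\<close>

lemma holomorphic2_onI:
  assumes "\<And>z. z \<in> U \<Longrightarrow> (F has_derivative (\<lambda>h. A z * fst h + B z * snd h)) (at z)"
  shows "holomorphic2_on F U"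
  unfolding holomorphic2_on_def case_prod_unfold using assms by blast

lemma holomorphic2_onE:
  assumes "holomorphic2_on F U"
  shows "\<exists>A B. \<forall>z\<in>U. (F has_derivative (\<lambda>h. A z * fst h + B z * snd h)) (at z)"
proof -
  have "\<forall>z\<in>U. \<exists>A B. (F has_derivative (\<lambda>h. A * fst h + B * snd h)) (at z)"
    using assms by (simp add: holomorphic2_on_def case_prod_unfold)
  then obtain A where "\<forall>z\<in>U. \<exists>B. (F has_derivative (\<lambda>h. A z * fst h + B * snd h)) (at z)"
    by (subst (asm) bchoice_iff) blast
  thus ?thesis by (subst (asm) bchoice_iff) blast
qed

lemma holomorphic2_on_subset: "holomorphic2_on F U \<Longrightarrow> V \<subseteq> U \<Longrightarrow> holomorphic2_on F V"
  unfolding holomorphic2_on_def by blast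

lemma holomorphic2_on_UN:
  "(\<And>i. i \<in> I \<Longrightarrow> holomorphic2_on F (U i)) \<Longrightarrow> holomorphic2_on F (\<Union>i\<in>I. U i)"
  unfolding holomorphic2_on_def by blast

lemma holomorphic2_on_add:
  assumes "holomorphic2_on F U" "holomorphic2_on G U"
  shows "holomorphic2_on (\<lambda>z. F z + G z) U"
proof -
  obtain A B where F: "\<And>z. z \<in> U \<Longrightarrow> (F has_derivative (\<lambda>h. A z * fst h + B z * snd h)) (at z)"
    using holomorphic2_onE[OF assms(1)] by blast
  obtain A' B' where G: "\<And>z. z \<in> U \<Longrightarrow> (G has_derivative (\<lambda>h. A' z * fst h + B' z * snd h)) (at z)"
    using holomorphic2_onE[OF assms(2)] by blast
  show ?thesis
  proof (rule holomorphic2_onI)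
    fix z assume z: "z \<in> U"
    show "((\<lambda>z. F z + G z) has_derivative (\<lambda>h. (A z + A' z) * fst h + (B z + B' z) * snd h)) (at z)"
      by (rule has_derivative_eq_rhs[OF has_derivative_add[OF F[OF z] G[OF z]]])
         (simp add: fun_eq_iff algebra_simps)
  qed
qed

lemma holomorphic2_on_mult:
  assumes "holomorphic2_on F U" "holomorphic2_on G U"
  shows "holomorphic2_on (\<lambda>z. F z * G z) U"
proof -
  obtain A B where F: "\<And>z. z \<in> U \<Longrightarrow> (F has_derivative (\<lambda>h. A z * fst h + B z * snd h)) (at z)"
    using holomorphic2_onE[OF assms(1)] by blast
  obtain A' B' where G: "\<And>z. z \<in> U \<Longrightarrow> (G has_derivative (\<lambda>h. A' z * fst h + B' z * snd h)) (at z)"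
    using holomorphic2_onE[OF assms(2)] by blast
  show ?thesis
  proof (rule holomorphic2_onI)
    fix z assume z: "z \<in> U"
    show "((\<lambda>z. F z * G z) has_derivative
        (\<lambda>h. (F z * A' z + A z * G z) * fst h + (F z * B' z + B z * G z) * snd h)) (at z)"
      by (rule has_derivative_eq_rhs[OF has_derivative_mult[OF F[OF z] G[OF z]]])
         (simp add: fun_eq_iff algebra_simps)
  qed
qed

lemma holomorphic2_on_compose_linear:
  assumes "f holomorphic_on V" "open V" "\<And>z. z \<in> U \<Longrightarrow> a * fst z + b * snd z + c \<in> V"
  shows "holomorphic2_on (\<lambda>z. f (a * fst z + b * snd z + c)) U"
proof (rule holomorphic2_onI)
  fix z assume z: "z \<in> U"
  define w where "w = a * fst z + b * snd z + c"
  have "(f has_field_derivative deriv f w) (at w)"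
    using assms z by (auto simp: w_def intro!: holomorphic_derivI)
  hence "((\<lambda>z. f (a * fst z + b * snd z + c)) has_derivative
            (\<lambda>h. deriv f w * (a * fst h + b * snd h))) (at z)"
    unfolding has_field_derivative_def w_def
    by (rule has_derivative_compose[rotated]) (auto intro!: derivative_eq_intros)
  thus "((\<lambda>z. f (a * fst z + b * snd z + c)) has_derivative
          (\<lambda>h. (deriv f (a * fst z + b * snd z + c) * a) * fst h + (deriv f (a * fst z + b * snd z + c) * b) * snd h)) (at z)"
    by (simp add: w_def algebra_simps)
qed

lemma has_field_derivative_slice:
  assumes "(F has_derivative (\<lambda>h. A * fst h + B * snd h)) (at (a, b))"
  shows "((\<lambda>w. F (a, w)) has_field_derivative B) (at b)"
    and "((\<lambda>w. F (w, b)) has_field_derivative A) (at a)"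
proof -
  have "((\<lambda>w. (a, w)) has_derivative (\<lambda>h. (0, h))) (at b)"
    by (auto intro!: derivative_eq_intros)
  from has_derivative_compose[OF this assms]
  show "((\<lambda>w. F (a, w)) has_field_derivative B) (at b)"
    by (simp add: has_field_derivative_def)
  have "((\<lambda>w. (w, b)) has_derivative (\<lambda>h. (h, 0))) (at a)"
    by (auto intro!: derivative_eq_intros)
  from has_derivative_compose[OF this assms]
  show "((\<lambda>w. F (w, b)) has_field_derivative A) (at a)"
    by (simp add: has_field_derivative_def)
qed

text \<open>Cauchy's inequality for a prescribed derivative, ready for the partial derivatives of a
  function of two variables along its slices.\<close>

lemma norm_deriv_le_of_bounded:
  fixes f :: "complex \<Rightarrow> complex"
  assumes "0 < r" "\<And>w. w \<in> cball a r \<Longrightarrow> (f has_field_derivative f' w) (at w)"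
    and "\<And>w. w \<in> cball a r \<Longrightarrow> norm (f w) \<le> M"
  shows "norm (f' a) \<le> M / r"
proof -
  have "f holomorphic_on cball a r"
    unfolding holomorphic_on_def field_differentiable_def
    using has_field_derivative_at_within[OF assms(2)] by blast
  hence "norm ((deriv ^^ 1) f a) \<le> fact 1 * M / r ^ 1"
    using assms by (intro Cauchy_inequality)
      (auto simp: dist_norm intro: holomorphic_on_subset holomorphic_on_imp_continuous_on)
  moreover have "deriv f a = f' a"
    using assms by (intro DERIV_imp_deriv) auto
  ultimately show ?thesis by simp
qed

text \<open>The Weierstrass theorem in two variables. Cauchy's inequality on the two slices through
  a point bounds both partial derivatives of \<open>f n\<close> by \<open>M n / r\<close>, so the
  differentiated series converge uniformly near z and termwise differentiation applies.\<close>

lemma holomorphic2_on_suminf: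
  fixes f :: "nat \<Rightarrow> complex \<times> complex \<Rightarrow> complex"
  assumes "open S" "\<And>n. holomorphic2_on (f n) S"
    and M: "\<And>n z. z \<in> S \<Longrightarrow> norm (f n z) \<le> M n" "summable M"
  shows "holomorphic2_on (\<lambda>z. \<Sum>n. f n z) S"
proof -
  have "\<forall>n. \<exists>A B. \<forall>z\<in>S. (f n has_derivative (\<lambda>h. A z * fst h + B z * snd h)) (at z)"
    using holomorphic2_onE[OF assms(2)] by blast
  then obtain A where "\<forall>n. \<exists>B. \<forall>z\<in>S. (f n has_derivative (\<lambda>h. A n z * fst h + B z * snd h)) (at z)"
    by (subst (asm) choice_iff) blast
  then obtain B where "\<forall>n. \<forall>z\<in>S. (f n has_derivative (\<lambda>h. A n z * fst h + B n z * snd h)) (at z)"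
    by (subst (asm) choice_iff) blast
  hence D: "\<And>n z. z \<in> S \<Longrightarrow> (f n has_derivative (\<lambda>h. A n z * fst h + B n z * snd h)) (at z)"
    by blast
  show ?thesis
  proof (rule holomorphic2_onI)
    fix z assume z: "z \<in> S"
    then obtain e where e: "0 < e" "ball z e \<subseteq> S" using assms(1) openE by blast
    \<comment> \<open>Half the radius, so that slices of radius r around any point of
      \<open>ball z r\<close> stay inside \<open>S\<close>.\<close>
    define r where "r = e / 2"
    have r: "0 < r" using e by (simp add: r_def)
    have in_S: "y \<in> S" if "x \<in> ball z r" "dist x y \<le> r" for x y
    proof -
      have "dist z y < e" using that dist_triangle[of z y x] by (auto simp: r_def)
      thus ?thesis using e by auto
    qed
    have Ab: "norm (A n x) \<le> M n / r" and Bb: "norm (B n x) \<le> M n / r" if x: "x \<in> ball z r" for n x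
    proof -
      obtain a b where ab: "x = (a, b)" by (cases x)
      have 1: "(w, b) \<in> S" if "w \<in> cball a r" for w
        using that in_S[OF x, of "(w, b)"] by (simp add: ab dist_Pair_Pair)
      show "norm (A n x) \<le> M n / r"
        unfolding ab
        by (rule norm_deriv_le_of_bounded[OF r has_field_derivative_slice(2)[OF D[OF 1]] M(1)[OF 1]])
      have 2: "(a, w) \<in> S" if "w \<in> cball b r" for w
        using that in_S[OF x, of "(a, w)"] by (simp add: ab dist_Pair_Pair)
      show "norm (B n x) \<le> M n / r"
        unfolding ab
        by (rule norm_deriv_le_of_bounded[OF r has_field_derivative_slice(1)[OF D[OF 2]] M(1)[OF 2]])
    qed
    have Mr: "summable (\<lambda>n. M n / r)" using M(2) by (rule summable_divide)
    have uA: "uniform_limit (ball z r) (\<lambda>n x. \<Sum>i<n. A i x) (\<lambda>x. \<Sum>i. A i x) sequentially"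
      by (rule Weierstrass_m_test[OF Ab Mr])
    have uB: "uniform_limit (ball z r) (\<lambda>n x. \<Sum>i<n. B i x) (\<lambda>x. \<Sum>i. B i x) sequentially"
      by (rule Weierstrass_m_test[OF Bb Mr])
    have sm: "summable (\<lambda>n. f n x)" if "x \<in> S" for x
      by (rule summable_comparison_test'[OF M(2) M(1)[OF that]])
    have "\<exists>g. \<forall>x\<in>ball z r. (\<lambda>n. f n x) sums g x \<and>
        (g has_derivative (\<lambda>h. (\<Sum>i. A i x) * fst h + (\<Sum>i. B i x) * snd h)) (at x within ball z r)"
    proof (rule has_derivative_series[where x = z and f = f and
          f' = "\<lambda>n x h. A n x * fst h + B n x * snd h" and
          g' = "\<lambda>x h. (\<Sum>i. A i x) * fst h + (\<Sum>i. B i x) * snd h"])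
      fix n x assume "x \<in> ball z r"
      hence "x \<in> S" by (rule in_S) (use r in simp)
      thus "(f n has_derivative (\<lambda>h. A n x * fst h + B n x * snd h)) (at x within ball z r)"
        by (rule has_derivative_at_withinI[OF D])
    next
      fix e :: real assume "0 < e"
      hence e2: "0 < e / 2" by simp
      have "\<forall>\<^sub>F n in sequentially. \<forall>x\<in>ball z r. dist (\<Sum>i<n. A i x) (\<Sum>i. A i x) < e / 2"
            "\<forall>\<^sub>F n in sequentially. \<forall>x\<in>ball z r. dist (\<Sum>i<n. B i x) (\<Sum>i. B i x) < e / 2"
        by (rule uniform_limitD[OF uA e2], rule uniform_limitD[OF uB e2])
      thus "\<forall>\<^sub>F n in sequentially. \<forall>x\<in>ball z r. \<forall>h. norm ((\<Sum>i<n. A i x * fst h + B i x * snd h)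
               - ((\<Sum>i. A i x) * fst h + (\<Sum>i. B i x) * snd h)) \<le> e * norm h"
      proof eventually_elim
        case (elim n)
        show ?case
        proof (intro ballI allI)
          fix x and h :: "complex \<times> complex" assume x: "x \<in> ball z r"
          have "(\<Sum>i<n. A i x * fst h + B i x * snd h) - ((\<Sum>i. A i x) * fst h + (\<Sum>i. B i x) * snd h)
             = ((\<Sum>i<n. A i x) - (\<Sum>i. A i x)) * fst h + ((\<Sum>i<n. B i x) - (\<Sum>i. B i x)) * snd h"
            unfolding sum.distrib sum_distrib_right [symmetric] left_diff_distrib by (rule add_diff_add)
          also have "norm \<dots> \<le> norm ((\<Sum>i<n. A i x) - (\<Sum>i. A i x)) * norm (fst h) + norm ((\<Sum>i<n. B i x) - (\<Sum>i. B i x)) * norm (snd h)"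
            by (rule order_trans[OF norm_triangle_ineq]) (simp only: norm_mult order_refl)
          also have "\<dots> \<le> e / 2 * norm h + e / 2 * norm h"
          proof (intro add_mono mult_mono)
            show "norm ((\<Sum>i<n. A i x) - (\<Sum>i. A i x)) \<le> e / 2"
              using bspec[OF elim(1) x] by (simp only: dist_norm)
            show "norm ((\<Sum>i<n. B i x) - (\<Sum>i. B i x)) \<le> e / 2"
              using bspec[OF elim(2) x] by (simp only: dist_norm)
            show "norm (fst h) \<le> norm h" "norm (snd h) \<le> norm h"
              using norm_fst_le[of "fst h" "snd h"] norm_snd_le[of "snd h" "fst h"] by simp_all
          qed (use \<open>0 < e\<close> in simp_all)
          finally show "norm ((\<Sum>i<n. A i x * fst h + B i x * snd h)
               - ((\<Sum>i. A i x) * fst h + (\<Sum>i. B i x) * snd h)) \<le> e * norm h" by simp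
        qed
      qed
    next
      show "(\<lambda>n. f n z) sums (\<Sum>n. f n z)" by (rule summable_sums[OF sm[OF z]])
    qed (use r in simp_all)
    then obtain g where "\<forall>x\<in>ball z r. (\<lambda>n. f n x) sums g x \<and>
        (g has_derivative (\<lambda>h. (\<Sum>i. A i x) * fst h + (\<Sum>i. B i x) * snd h)) (at x within ball z r)"
      by blast
    hence g: "\<And>x. x \<in> ball z r \<Longrightarrow> (\<lambda>n. f n x) sums g x"
      "(g has_derivative (\<lambda>h. (\<Sum>i. A i z) * fst h + (\<Sum>i. B i z) * snd h)) (at z within ball z r)"
      using r by (blast, simp)
    have "((\<lambda>x. \<Sum>n. f n x) has_derivative (\<lambda>h. (\<Sum>i. A i z) * fst h + (\<Sum>i. B i z) * snd h)) (at z within ball z r)"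
      by (rule has_derivative_transform[OF _ _ g(2)]) (use r g(1) in \<open>auto simp: sums_iff\<close>)
    thus "((\<lambda>x. \<Sum>n. f n x) has_derivative (\<lambda>h. (\<Sum>i. A i z) * fst h + (\<Sum>i. B i z) * snd h)) (at z)"
      by (subst (asm) at_within_open) (use r in simp_all)
  qed
qed

text \<open>On a small disc around s both |w| and 1 / Re w stay bounded, so the termwise bound gives
  a Weierstrass majorant with exponent - q - 1, where q = Re s / 2.\<close>

lemma holomorphic_on_em_rem:
  assumes "1 \<le> x"
  shows "em_rem x holomorphic_on ({s. 0 < Re s} - {1})"
proof (rule holomorphic_uniform_sequence)
  let ?S = "{s. 0 < Re s} - {1 :: complex}"
  show "open ?S" by (intro open_Diff open_halfspace_Re_gt) auto
  show "(\<lambda>s. \<Sum>j<n. em_term (x + real j) s) holomorphic_on ?S" for n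
  proof -
    have "complex_of_real (x + real j) \<noteq> 0" "complex_of_real (x + real j + 1) \<noteq> 0" for j
      unfolding of_real_eq_0_iff using assms by linarith+
    thus ?thesis unfolding em_term_def by (intro holomorphic_intros) auto
  qed
  fix s assume s: "s \<in> ?S"
  define q where "q = Re s / 2"
  have q: "0 < q" using s by (simp add: q_def)
  have "open (?S \<inter> {s. q < Re s})"
    by (intro open_Int open_Diff open_halfspace_Re_gt) auto
  moreover have "s \<in> ?S \<inter> {s. q < Re s}" using s by (auto simp: q_def)
  ultimately obtain d where d: "0 < d" "cball s d \<subseteq> ?S \<inter> {s. q < Re s}"
    using open_contains_cball by metis
  have "uniform_limit (cball s d) (\<lambda>n w. \<Sum>j<n. em_term (x + real j) w) (\<lambda>w. \<Sum>j. em_term (x + real j) w) sequentially"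
  proof (rule Weierstrass_m_test)
    show "summable (\<lambda>j. (norm s + d) * (x + real j) powr (- q - 1))"
      using assms q by (intro summable_mult summable_powr_shift) auto
    fix j w assume w: "w \<in> cball s d"
    have "q < Re w" "w \<noteq> 1" "0 < Re w" using w d(2) by auto
    have "norm w \<le> norm s + d"
      using w norm_triangle_sub[of w s] by (simp add: dist_norm norm_minus_commute)
    have "norm (em_term (x + real j) w) \<le> norm w * (x + real j) powr (- Re w - 1)"
      using assms \<open>w \<noteq> 1\<close> \<open>0 < Re w\<close> by (intro norm_em_term_le) auto
    also have "\<dots> \<le> (norm s + d) * (x + real j) powr (- q - 1)"
      using \<open>norm w \<le> _\<close> \<open>q < Re w\<close> assms d by (intro mult_mono powr_mono) auto
    finally show "norm (em_term (x + real j) w) \<le> (norm s + d) * (x + real j) powr (- q - 1)" .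
  qed
  thus "\<exists>d>0. cball s d \<subseteq> ?S \<and> uniform_limit (cball s d) (\<lambda>n s. \<Sum>j<n. em_term (x + real j) s) (em_rem x) sequentially"
    unfolding em_rem_def using d by (intro exI[of _ d]) auto
qed

section \<open>Continuation of the double zeta function\<close>

lemma norm_of_nat_powr:
  "0 < n \<Longrightarrow> norm (of_nat n powr z :: complex) = real n powr Re z"
  using norm_of_real_powr[of "real n" z] by simp

lemma open_right_half_plane_minus_1: "open ({s. 0 < Re s} - {1})"
  by (intro open_Diff open_halfspace_Re_gt) auto

text \<open>The Riemann zeta function on Re v > 0, v \<noteq> 1: the term for k = 1 plus the
  continued tail beyond 1.\<close>

definition zeta_cont :: "complex \<Rightarrow> complex" where
  "zeta_cont v = 1 + 1 / (v - 1) + em_rem 1 v"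

definition double_zeta_cont :: "complex \<times> complex \<Rightarrow> complex" where
  "double_zeta_cont = (\<lambda>(s1, s2). zeta_cont (s1 + s2 - 1) / (s2 - 1) +
     (\<Sum>i. of_nat (Suc i) powr (- s1) * em_rem (real (Suc i)) s2))"

lemma zeta_cont_sums:
  assumes "1 < Re v"
  shows "(\<lambda>i. of_nat (Suc i) powr (- v)) sums zeta_cont v"
proof -
  have "(\<lambda>i. of_nat (Suc (Suc i)) powr (- v)) sums (1 / (v - 1) + em_rem 1 v)"
    using sums_of_real_powr_shift[of 1 v] assms
    by (simp only: of_real_add of_real_1 of_real_of_nat_eq of_nat_Suc powr_one_eq_one)
  hence "(\<lambda>i. of_nat (Suc i) powr (- v)) sums (1 / (v - 1) + em_rem 1 v + of_nat (Suc 0) powr (- v))"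
    by (rule sums_Suc[where f = "\<lambda>i. of_nat (Suc i) powr (- v)"])
  thus ?thesis by (simp add: zeta_cont_def add_ac)
qed

lemma norm_dirichlet_em_rem_le:
  assumes "s2 \<noteq> 1" "0 < Re s2"
  shows "norm (of_nat (Suc i) powr (- s1) * em_rem (real (Suc i)) s2)
    \<le> norm s2 * (1 + 1 / Re s2) * real (Suc i) powr (- Re (s1 + s2))"
proof -
  have "norm (of_nat (Suc i) powr (- s1) * em_rem (real (Suc i)) s2)
     \<le> real (Suc i) powr (- Re s1) * (norm s2 * (1 + 1 / Re s2) * real (Suc i) powr (- Re s2))"
    unfolding norm_mult norm_of_nat_powr[OF zero_less_Suc] uminus_complex.sel
    using assms by (intro mult_left_mono norm_em_rem_le) auto
  also have "\<dots> = norm s2 * (1 + 1 / Re s2) * real (Suc i) powr (- Re (s1 + s2))"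
    by (simp add: powr_add [symmetric] del: of_nat_Suc)
  finally show ?thesis .
qed

lemma summable_real_Suc_powr:
  assumes "1 < p"
  shows "summable (\<lambda>i. real (Suc i) powr (- p))"
  using summable_powr_shift[of 1 "p - 1"] assms by simp

lemma summable_dirichlet_em_rem:
  assumes "s2 \<noteq> 1" "0 < Re s2" "1 < Re (s1 + s2)"
  shows "summable (\<lambda>i. of_nat (Suc i) powr (- s1) * em_rem (real (Suc i)) s2)"
proof (rule summable_comparison_test')
  show "summable (\<lambda>i. (norm s2 * (1 + 1 / Re s2)) * real (Suc i) powr (- Re (s1 + s2)))"
    by (intro summable_mult summable_real_Suc_powr assms)
qed (rule norm_dirichlet_em_rem_le[OF assms(1,2)])

text \<open>No single summable majorant serves the whole region: the bound degenerates as Re s2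
  \<rightarrow> 0, Re (s1 + s2) \<rightarrow> 1 or |s2| \<rightarrow> \<infinity>. The open sets
  \<open>W (\<eta>, p, B)\<close> keep away from all three and exhaust the region, and holomorphy is
  local.\<close>

lemma holomorphic2_on_dirichlet_em_rem:
  "holomorphic2_on (\<lambda>z. \<Sum>i. of_nat (Suc i) powr (- fst z) * em_rem (real (Suc i)) (snd z))
     {z. 0 < Re (snd z) \<and> 1 < Re (fst z + snd z) \<and> snd z \<noteq> 1}"
proof -
  define W where "W = (\<lambda>(\<eta>::real, p::real, B::real). {z :: complex \<times> complex.
     \<eta> < Re (snd z) \<and> p < Re (fst z + snd z) \<and> norm (snd z) < B \<and> snd z \<noteq> 1})"
  define I where "I = {(\<eta>::real, p::real, B::real). 0 < \<eta> \<and> 1 < p}"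
  have "holomorphic2_on (\<lambda>z. \<Sum>i. of_nat (Suc i) powr (- fst z) * em_rem (real (Suc i)) (snd z)) (\<Union>i\<in>I. W i)"
  proof (rule holomorphic2_on_UN)
    fix j assume "j \<in> I"
    then obtain \<eta> p B where j: "j = (\<eta>, p, B)" "0 < \<eta>" "1 < p" by (auto simp: I_def)
    show "holomorphic2_on (\<lambda>z. \<Sum>i. of_nat (Suc i) powr (- fst z) * em_rem (real (Suc i)) (snd z)) (W j)"
    proof (rule holomorphic2_on_suminf)
      show "open (W j)"
        unfolding W_def j by (simp, intro open_Collect_conj open_Collect_less open_Collect_neq continuous_intros)
      show "holomorphic2_on (\<lambda>z. of_nat (Suc i) powr (- fst z) * em_rem (real (Suc i)) (snd z)) (W j)" for i
      proof (rule holomorphic2_on_mult)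
        have "(\<lambda>w. of_nat (Suc i) powr w :: complex) holomorphic_on UNIV"
          by (intro holomorphic_intros) (auto simp del: of_nat_Suc)
        from holomorphic2_on_compose_linear[OF this, of "W j" "-1" 0 0]
        show "holomorphic2_on (\<lambda>z. of_nat (Suc i) powr (- fst z)) (W j)" by simp
        have "em_rem (real (Suc i)) holomorphic_on ({s. 0 < Re s} - {1})"
          by (rule holomorphic_on_em_rem) simp
        from holomorphic2_on_compose_linear[OF this, of "W j" 0 1 0]
        show "holomorphic2_on (\<lambda>z. em_rem (real (Suc i)) (snd z)) (W j)"
          using j open_right_half_plane_minus_1 by (auto simp: W_def)
      qed
      show "summable (\<lambda>i. (B * (1 + 1 / \<eta>)) * real (Suc i) powr (- p))"
        using j by (intro summable_mult summable_real_Suc_powr)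
      fix i z assume z: "z \<in> W j"
      have h: "\<eta> < Re (snd z)" "p < Re (fst z + snd z)" "norm (snd z) < B" "snd z \<noteq> 1"
        using z by (auto simp: W_def j)
      have "0 \<le> norm (snd z)" by simp
      hence B: "0 < B" using h by linarith
      have "norm (of_nat (Suc i) powr (- fst z) * em_rem (real (Suc i)) (snd z))
         \<le> norm (snd z) * (1 + 1 / Re (snd z)) * real (Suc i) powr (- Re (fst z + snd z))"
        using h j by (intro norm_dirichlet_em_rem_le) auto
      also have "\<dots> \<le> B * (1 + 1 / \<eta>) * real (Suc i) powr (- p)"
        using h j B by (intro mult_mono add_mono divide_left_mono powr_mono) auto
      finally show "norm (of_nat (Suc i) powr (- fst z) * em_rem (real (Suc i)) (snd z))
          \<le> B * (1 + 1 / \<eta>) * real (Suc i) powr (- p)" .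
    qed
  qed
  moreover have "{z. 0 < Re (snd z) \<and> 1 < Re (fst z + snd z) \<and> snd z \<noteq> 1} \<subseteq> (\<Union>i\<in>I. W i)"
  proof
    fix z :: "complex \<times> complex"
    assume "z \<in> {z. 0 < Re (snd z) \<and> 1 < Re (fst z + snd z) \<and> snd z \<noteq> 1}"
    hence "z \<in> W (Re (snd z) / 2, (1 + Re (fst z + snd z)) / 2, norm (snd z) + 1)"
          "(Re (snd z) / 2, (1 + Re (fst z + snd z)) / 2, norm (snd z) + 1) \<in> I"
      by (auto simp: W_def I_def field_simps)
    thus "z \<in> (\<Union>i\<in>I. W i)" by blast
  qed
  ultimately show ?thesis by (rule holomorphic2_on_subset)
qed

lemma holomorphic2_on_double_zeta_cont:
  "holomorphic2_on double_zeta_cont (double_zeta_halfspaces 0 1 - double_zeta_sing)"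
proof -
  let ?U = "double_zeta_halfspaces 0 1 - double_zeta_sing"
  have zc: "zeta_cont holomorphic_on ({s. 0 < Re s} - {1})"
    unfolding zeta_cont_def by (intro holomorphic_intros holomorphic_on_em_rem) auto
  have 1: "holomorphic2_on (\<lambda>z. zeta_cont (1 * fst z + 1 * snd z + (-1))) ?U"
  proof (rule holomorphic2_on_compose_linear[OF zc])
    show "open ({s. 0 < Re s} - {1})" by (rule open_right_half_plane_minus_1)
    fix z assume z: "z \<in> ?U"
    have "1 < Re (fst z + snd z)" "fst z + snd z \<noteq> 2"
      using z by (auto simp: double_zeta_halfspaces_def double_zeta_sing_def)
    moreover have "w - 1 \<in> {s. 0 < Re s} - {1}" if "1 < Re w" "w \<noteq> 2" for w
      using that by (auto simp: diff_eq_eq)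
    ultimately show "1 * fst z + 1 * snd z + (-1) \<in> {s. 0 < Re s} - {1}"
      by (simp only: mult_1 diff_conv_add_uminus)
  qed
  have "(\<lambda>w::complex. 1 / (w - 1)) holomorphic_on (UNIV - {1})"
    by (intro holomorphic_intros) auto
  moreover have "open (UNIV - {1 :: complex})" by (intro open_Diff) auto
  ultimately have "(\<And>z. z \<in> ?U \<Longrightarrow> 0 * fst z + 1 * snd z + 0 \<in> UNIV - {1}) \<Longrightarrow>
      holomorphic2_on (\<lambda>z. 1 / (0 * fst z + 1 * snd z + 0 - 1)) ?U"
    by (rule holomorphic2_on_compose_linear)
  hence 2: "holomorphic2_on (\<lambda>z. 1 / (snd z - 1)) ?U"
    by (auto simp: double_zeta_sing_def)
  have 3: "holomorphic2_on (\<lambda>z. \<Sum>i. of_nat (Suc i) powr (- fst z) * em_rem (real (Suc i)) (snd z)) ?U"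
    by (rule holomorphic2_on_subset[OF holomorphic2_on_dirichlet_em_rem])
       (auto simp: double_zeta_halfspaces_def double_zeta_sing_def)
  show ?thesis
    using holomorphic2_on_add[OF holomorphic2_on_mult[OF 1 2] 3]
    by (simp add: double_zeta_cont_def case_prod_unfold)
qed

text \<open>The inner sum is the tail beyond \<open>Suc i\<close>. Multiplied by the outer power,
  its main part has exponent s1 + s2 - 1, of real part above 1, and sums to the zeta value; the
  remainder part converges on its own.\<close>

lemma double_zeta_cont_eq_series:
  assumes "1 < Re s2" "2 < Re (s1 + s2)"
  shows "double_zeta_cont (s1, s2) = double_zeta_series s1 s2"
proof -
  have s2: "s2 \<noteq> 1" using assms by auto
  have inner: "(\<Sum>j. of_nat (Suc i + Suc j) powr (- s2)) = of_nat (Suc i) powr (1 - s2) / (s2 - 1) + em_rem (real (Suc i)) s2" for i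
  proof -
    have "(\<lambda>j. of_nat (Suc i + Suc j) powr (- s2)) sums (of_nat (Suc i) powr (1 - s2) / (s2 - 1) + em_rem (real (Suc i)) s2)"
      using sums_of_real_powr_shift[of "real (Suc i)" s2] assms
      by (simp only: of_real_of_nat_eq of_nat_add [symmetric])
    thus ?thesis by (rule sums_unique[symmetric])
  qed
  have "(\<lambda>i. of_nat (Suc i) powr (- (s1 + s2 - 1)) / (s2 - 1)) sums (zeta_cont (s1 + s2 - 1) / (s2 - 1))"
    using assms by (intro sums_divide zeta_cont_sums) auto
  moreover have "(\<lambda>i. of_nat (Suc i) powr (- s1) * em_rem (real (Suc i)) s2) sums
      (\<Sum>i. of_nat (Suc i) powr (- s1) * em_rem (real (Suc i)) s2)"
    using assms s2 by (intro summable_sums summable_dirichlet_em_rem) auto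
  ultimately have "(\<lambda>i. of_nat (Suc i) powr (- (s1 + s2 - 1)) / (s2 - 1) + of_nat (Suc i) powr (- s1) * em_rem (real (Suc i)) s2)
      sums double_zeta_cont (s1, s2)"
    unfolding double_zeta_cont_def case_prod_conv by (rule sums_add)
  moreover have "of_nat (Suc i) powr (- (s1 + s2 - 1)) / (s2 - 1) + of_nat (Suc i) powr (- s1) * em_rem (real (Suc i)) s2
     = of_nat (Suc i) powr (- s1) * (of_nat (Suc i) powr (1 - s2) / (s2 - 1) + em_rem (real (Suc i)) s2)" for i
  proof -
    have "of_nat (Suc i) powr (- (s1 + s2 - 1)) = of_nat (Suc i) powr (- s1) * of_nat (Suc i) powr (1 - s2)"
      by (simp add: powr_add [symmetric] algebra_simps)
    thus ?thesis by (simp only: distrib_left times_divide_eq_right)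
  qed
  ultimately show ?thesis
    unfolding double_zeta_series_def inner by (simp add: sums_iff)
qed

section \<open>The singular set on a slice and uniqueness of the continuation\<close>

text \<open>Writing the infinite family as an affine preimage of the natural numbers makes
  closedness immediate.\<close>

lemma double_zeta_sing_slice:
  "{w. (a, w) \<in> double_zeta_sing} =
     {1, 2 - a, 1 - a} \<union> (\<lambda>w. - (a + w) / 2) -` range of_nat"
proof -
  have "- (a + w) / 2 = of_nat k \<longleftrightarrow> a + w = - (2 * of_nat k)" for w :: complex and k :: nat
    by (metis (no_types) minus_equation_iff mult.commute nonzero_divide_eq_eq zero_neq_numeral)
  thus ?thesis
    unfolding double_zeta_sing_def image_def vimage_def
    by (auto simp: eq_diff_eq add.commute)
qed

lemma closed_double_zeta_sing_slice: "closed {w. (a, w) \<in> double_zeta_sing}"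
  unfolding double_zeta_sing_slice
  by (intro closed_Un finite_imp_closed continuous_closed_vimage closed_of_nat_image)
     (auto intro!: continuous_intros)

text \<open>Deleting a countable set leaves an open half-plane connected, as the identity theorem
  requires.\<close>

lemma countable_double_zeta_sing_slice: "countable {w. (a, w) \<in> double_zeta_sing}"
proof (rule countable_subset)
  have "w = - (2 * of_nat k) - a" if "- (a + w) / 2 = of_nat k" for w and k :: nat
    using that by (simp add: field_simps) (metis add.commute add_diff_cancel_left' diff_minus_eq_add minus_diff_eq uminus_add_conv_diff)
  thus "{w. (a, w) \<in> double_zeta_sing} \<subseteq> {1, 2 - a, 1 - a} \<union> range (\<lambda>k::nat. - (2 * of_nat k) - a)"
    unfolding double_zeta_sing_slice by blast
qed auto

text \<open>Uniqueness needs only the identity theorem in one variable, with \<open>s1\<close> fixed.\<close>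

lemma double_zeta_continuation_unique:
  assumes F: "is_double_zeta_continuation F (double_zeta_halfspaces a b)"
    and G: "is_double_zeta_continuation G (double_zeta_halfspaces a' b')"
    and "(s1, s2) \<in> double_zeta_halfspaces a b" "(s1, s2) \<in> double_zeta_halfspaces a' b'"
    and "(s1, s2) \<notin> double_zeta_sing"
  shows "F (s1, s2) = G (s1, s2)"
proof -
  \<comment> \<open>With \<open>s1\<close> fixed, Re w > m says that (s1, w) lies in both domains;
    Re w > m' puts it in the region of convergence as well, where F and G equal the series.\<close>
  define m where "m = max (max a a') (max b b' - Re s1)"
  define m' where "m' = max m (max 1 (2 - Re s1))"
  define T where "T = {w. (s1, w) \<in> double_zeta_sing}"
  have clT: "closed T" unfolding T_def by (rule closed_double_zeta_sing_slice)
  have cT: "countable T" unfolding T_def by (rule countable_double_zeta_sing_slice)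
  have sub: "w \<in> {w. m < Re w} - T \<Longrightarrow> (s1, w) \<in> double_zeta_halfspaces a b - double_zeta_sing"
            "w \<in> {w. m < Re w} - T \<Longrightarrow> (s1, w) \<in> double_zeta_halfspaces a' b' - double_zeta_sing" for w
    by (auto simp: m_def T_def double_zeta_halfspaces_def)
  have hol: "(\<lambda>w. H (s1, w)) holomorphic_on ({w. m < Re w} - T)"
    if H: "holomorphic2_on H V" and V: "\<And>w. w \<in> {w. m < Re w} - T \<Longrightarrow> (s1, w) \<in> V" for H V
  proof -
    obtain A B where AB: "\<forall>z\<in>V. (H has_derivative (\<lambda>h. A z * fst h + B z * snd h)) (at z)"
      using holomorphic2_onE[OF H] by blast
    have "((\<lambda>w. H (s1, w)) has_field_derivative B (s1, w)) (at w)" if "w \<in> {w. m < Re w} - T" for w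
      by (rule has_field_derivative_slice(1)[OF bspec[OF AB V[OF that]]])
    thus ?thesis
      unfolding holomorphic_on_def field_differentiable_def
      by (blast intro: has_field_derivative_at_within)
  qed
  show ?thesis
  proof (rule analytic_continuation_open[where f = "\<lambda>w. F (s1, w)" and g = "\<lambda>w. G (s1, w)" and s = "{w. m' < Re w} - T" and s' = "{w. m < Re w} - T"])
    show "open ({w. m' < Re w} - T)" "open ({w. m < Re w} - T)"
      using clT by (auto intro!: open_Diff open_halfspace_Re_gt)
    \<comment> \<open>Real parts decide: m' + 1 \<ge> 2 and Re s1 + m' + 1 \<ge> 3, beyond every
      singular value.\<close>
    have "complex_of_real (m' + 1) \<notin> T"
    proof
      assume "complex_of_real (m' + 1) \<in> T"
      hence "m' + 1 = 1 \<or> Re s1 + (m' + 1) = 2 \<or> Re s1 + (m' + 1) = 1 \<or> (\<exists>k::nat. Re s1 + (m' + 1) = - (2 * real k))"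
        unfolding T_def double_zeta_sing_def by (auto simp: complex_eq_iff)
      thus False by (auto simp: m'_def max_def split: if_splits)
    qed
    hence "complex_of_real (m' + 1) \<in> {w. m' < Re w} - T" by simp
    thus "{w. m' < Re w} - T \<noteq> {}" by blast
    show "connected ({w. m < Re w} - T)"
      using cT by (intro connected_open_diff_countable open_halfspace_Re_gt convex_connected convex_halfspace_Re_gt) auto
    show "{w. m' < Re w} - T \<subseteq> {w. m < Re w} - T" by (auto simp: m'_def)
    show "(\<lambda>w. F (s1, w)) holomorphic_on ({w. m < Re w} - T)"
      using F sub(1) unfolding is_double_zeta_continuation_def by (blast intro: hol)
    show "(\<lambda>w. G (s1, w)) holomorphic_on ({w. m < Re w} - T)"
      using G sub(2) unfolding is_double_zeta_continuation_def by (blast intro: hol)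
    show "s2 \<in> {w. m < Re w} - T"
      using assms(3-5) by (auto simp: T_def m_def double_zeta_halfspaces_def)
    fix w assume w: "w \<in> {w. m' < Re w} - T"
    have wm: "w \<in> {w. m < Re w} - T" using w by (auto simp: m'_def)
    have "(s1, w) \<in> double_zeta_conv_region"
      using w by (auto simp: m'_def double_zeta_conv_region_def)
    hence "F (s1, w) = double_zeta_series s1 w" "G (s1, w) = double_zeta_series s1 w"
      using F G sub[OF wm] unfolding is_double_zeta_continuation_def by fast+
    thus "F (s1, w) = G (s1, w)" by simp
  qed
qed

text \<open>\<open>double_zeta_cont\<close> is one admissible continuation, and uniqueness makes
  every other one agree with it at the point. With Re (s1 + s2) > 1 only the hyperplanes s2 = 1 and
  s1 + s2 = 2 have to be avoided.\<close>

lemma double_zeta_eq_cont: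
  assumes "0 < Re s2" "1 < Re (s1 + s2)" "s2 \<noteq> 1" "s1 + s2 \<noteq> 2"
  shows "double_zeta s1 s2 = double_zeta_cont (s1, s2)"
  unfolding double_zeta_def
proof (rule the_equality)
  have C: "is_double_zeta_continuation double_zeta_cont (double_zeta_halfspaces 0 1)"
    using holomorphic2_on_double_zeta_cont double_zeta_cont_eq_series
    by (auto simp: is_double_zeta_continuation_def double_zeta_conv_region_def)
  have U: "(s1, s2) \<in> double_zeta_halfspaces 0 1"
    using assms by (auto simp: double_zeta_halfspaces_def)
  have "Re (s1 + s2) \<noteq> Re (- (2 * of_nat k))" for k :: nat
    using assms(2) by simp
  hence "s1 + s2 \<noteq> - (2 * of_nat k)" for k :: nat
    by metis
  moreover have "s1 + s2 \<noteq> 1" using assms(2) by (metis less_irrefl one_complex.sel(1))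
  ultimately have N: "(s1, s2) \<notin> double_zeta_sing"
    using assms by (auto simp: double_zeta_sing_def)
  show "\<exists>a b F. (s1, s2) \<in> double_zeta_halfspaces a b \<and>
      is_double_zeta_continuation F (double_zeta_halfspaces a b) \<and> F (s1, s2) = double_zeta_cont (s1, s2)"
    using C U by blast
  show "w = double_zeta_cont (s1, s2)"
    if "\<exists>a b F. (s1, s2) \<in> double_zeta_halfspaces a b \<and>
      is_double_zeta_continuation F (double_zeta_halfspaces a b) \<and> F (s1, s2) = w" for w
    using that double_zeta_continuation_unique[OF _ C _ U N] by blast
qed

section \<open>The error term\<close>

text \<open>The remainder at 1 is moved to N by N - 1 steps; its boundary term at 1 cancels 1 / (v -
  1).\<close>

lemma zeta_cont_eq_partial_sum:
  assumes "1 \<le> N" "0 < Re v" "v \<noteq> 1"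
  shows "zeta_cont v = (\<Sum>i<N. of_nat (Suc i) powr (- v)) + of_nat N powr (1 - v) / (v - 1) + em_rem (real N) v"
proof -
  obtain M where M: "N = Suc M" using assms(1) by (cases N) auto
  have "em_rem 1 v = (\<Sum>j<M. of_real (1 + real (Suc j)) powr (- v))
     - (of_real 1 powr (1 - v) - of_real (1 + real M) powr (1 - v)) / (v - 1) + em_rem (1 + real M) v"
    using assms by (intro em_rem_shift) auto
  also have "(\<Sum>j<M. of_real (1 + real (Suc j)) powr (- v)) = (\<Sum>j<M. of_nat (Suc (Suc j)) powr (- v))"
    by simp
  also have "of_real (1 + real M) = (of_nat N :: complex)" by (simp add: M)
  also have "1 + real M = real N" by (simp add: M)
  finally show ?thesis
    unfolding zeta_cont_def M sum.lessThan_Suc_shift by (simp add: diff_divide_distrib)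
qed

text \<open>Raising the shift by one adds an ordinary telescoping series. Only v \<rightarrow> 0 is
  assumed, as the terms \<open>m powr - v\<close> to which this is applied need not be
  summable.\<close>

lemma telescope_shift_sums:
  fixes v :: "nat \<Rightarrow> 'a::real_normed_vector"
  assumes "v \<longlonglongrightarrow> 0"
  shows "(\<lambda>i. v i - v (i + N)) sums (\<Sum>i<N. v i)"
proof (induction N)
  case (Suc N)
  have "(\<lambda>i. v (i + N)) \<longlonglongrightarrow> 0" by (rule LIMSEQ_ignore_initial_segment[OF assms])
  from sums_add[OF Suc telescope_sums'[OF this]] show ?case by simp
qed simp

text \<open>Each remainder in \<open>double_zeta_cont\<close> is shifted by N: the extracted terms
  \<open>D\<close> form the truncated series, \<open>E\<close> holds the shifted remainders, and the
  boundary terms become \<open>V i - V (i + N)\<close> up to the correction \<open>Q\<close>. The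
  telescoped sum of \<open>V\<close> cancels the partial sum contained in
  \<open>zeta_cont v\<close>.\<close>

lemma double_zeta_cont_minus_partial:
  assumes "0 < Re s2" "1 < Re (s1 + s2)" "s2 \<noteq> 1" "s1 + s2 \<noteq> 2" "1 \<le> N"
  defines "v \<equiv> s1 + s2 - 1"
  shows "double_zeta_cont (s1, s2) - (\<Sum>i. \<Sum>n = 1..N. 1 / (of_nat (Suc i) powr s1 * of_nat (Suc i + n) powr s2))
     = (\<Sum>i. of_nat (Suc i) powr (- s1) * em_rem (real (Suc i + N)) s2)
       + (of_nat N powr (1 - v) / (v - 1) + em_rem (real N) v
          + (\<Sum>i. (of_nat (Suc i) powr (- s1) - of_nat (Suc i + N) powr (- s1)) * of_nat (Suc i + N) powr (1 - s2)))
         / (s2 - 1)"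
proof -
  define a :: "nat \<Rightarrow> complex" where "a = (\<lambda>i. of_nat (Suc i) powr (- s1))"
  define D where "D = (\<lambda>i. \<Sum>j<N. a i * of_nat (Suc i + Suc j) powr (- s2))"
  define E where "E = (\<lambda>i. a i * em_rem (real (Suc i + N)) s2)"
  define R where "R = (\<lambda>i. a i * em_rem (real (Suc i)) s2)"
  define V :: "nat \<Rightarrow> complex" where "V = (\<lambda>i. of_nat (Suc i) powr (- v))"
  define Q where "Q = (\<lambda>i. (a i - of_nat (Suc i + N) powr (- s1)) * of_nat (Suc i + N) powr (1 - s2))"
  have na: "norm (a i) = real (Suc i) powr (- Re s1)" for i
    unfolding a_def by (subst norm_of_nat_powr) auto
  have V_eq: "V i = a i * of_nat (Suc i) powr (1 - s2)"
             "V (i + N) = of_nat (Suc i + N) powr (- s1) * of_nat (Suc i + N) powr (1 - s2)" for i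
    unfolding V_def a_def v_def powr_add [symmetric] by (simp_all add: algebra_simps)
  have R_eq: "R i = D i - (V i - V (i + N)) / (s2 - 1) + Q i / (s2 - 1) + E i" for i
  proof -
    have "em_rem (real (Suc i)) s2 = (\<Sum>j<N. of_real (real (Suc i) + real (Suc j)) powr (- s2))
       - (of_real (real (Suc i)) powr (1 - s2) - of_real (real (Suc i) + real N) powr (1 - s2)) / (s2 - 1)
       + em_rem (real (Suc i) + real N) s2"
      using assms by (intro em_rem_shift) auto
    hence "em_rem (real (Suc i)) s2 = (\<Sum>j<N. of_nat (Suc i + Suc j) powr (- s2))
       - (of_nat (Suc i) powr (1 - s2) - of_nat (Suc i + N) powr (1 - s2)) / (s2 - 1)
       + em_rem (real (Suc i + N)) s2"
      by (simp only: of_nat_add [symmetric] of_real_of_nat_eq)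
    hence "R i = D i - (a i * of_nat (Suc i) powr (1 - s2) - a i * of_nat (Suc i + N) powr (1 - s2)) / (s2 - 1) + E i"
      unfolding R_def D_def E_def sum_distrib_left [symmetric]
      by (simp only: distrib_left right_diff_distrib times_divide_eq_right)
    also have "a i * of_nat (Suc i) powr (1 - s2) - a i * of_nat (Suc i + N) powr (1 - s2)
         = (V i - V (i + N)) - Q i"
      unfolding V_eq(1)[of i] V_eq(2)[of i] Q_def by (simp only: left_diff_distrib) simp
    finally show ?thesis by (simp only: diff_divide_distrib) simp
  qed
  have sp: "summable (\<lambda>i. c * real (Suc i) powr (- Re (s1 + s2)))" for c
    using assms by (intro summable_mult summable_real_Suc_powr)
  have pw: "real (Suc i) powr (- Re s1) * real (Suc i + k) powr (- Re s2) \<le> real (Suc i) powr (- Re (s1 + s2))" for i k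
  proof -
    have "real (Suc i) powr (- Re s1) * real (Suc i + k) powr (- Re s2) \<le> real (Suc i) powr (- Re s1) * real (Suc i) powr (- Re s2)"
      using assms by (intro mult_left_mono powr_mono2') auto
    also have "\<dots> = real (Suc i) powr (- Re (s1 + s2))"
      unfolding powr_add [symmetric] by simp
    finally show ?thesis .
  qed
  have sR: "summable R"
    unfolding R_def a_def using assms by (intro summable_dirichlet_em_rem) auto
  have sD: "summable D" unfolding D_def
  proof (intro summable_sum summable_comparison_test'[OF sp[of 1]])
    fix i j
    have "norm (a i * of_nat (Suc i + Suc j) powr (- s2)) = real (Suc i) powr (- Re s1) * real (Suc i + Suc j) powr (- Re s2)"
      unfolding norm_mult na by (subst norm_of_nat_powr) auto
    thus "norm (a i * of_nat (Suc i + Suc j) powr (- s2)) \<le> 1 * real (Suc i) powr (- Re (s1 + s2))"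
      using pw[of i "Suc j"] by linarith
  qed
  have sE: "summable E"
  proof (rule summable_comparison_test'[OF sp])
    fix i
    have "norm (E i) \<le> real (Suc i) powr (- Re s1) * (norm s2 * (1 + 1 / Re s2) * real (Suc i + N) powr (- Re s2))"
      unfolding E_def norm_mult na using assms by (intro mult_left_mono norm_em_rem_le) auto
    also have "\<dots> = norm s2 * (1 + 1 / Re s2) * (real (Suc i) powr (- Re s1) * real (Suc i + N) powr (- Re s2))"
      by (simp only: mult_ac)
    also have "\<dots> \<le> norm s2 * (1 + 1 / Re s2) * real (Suc i) powr (- Re (s1 + s2))"
      using assms by (intro mult_left_mono pw) auto
    finally show "norm (E i) \<le> norm s2 * (1 + 1 / Re s2) * real (Suc i) powr (- Re (s1 + s2))" .
  qed
  have "V \<longlonglongrightarrow> 0"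
    using tendsto_of_real_powr_shift[of "- v" 1] assms by (simp add: V_def v_def)
  hence V: "(\<lambda>i. V i - V (i + N)) sums (\<Sum>i<N. V i)"
    by (rule telescope_shift_sums)
  \<comment> \<open>Summability of \<open>Q\<close> comes without an estimate, by solving
    \<open>R_eq\<close> for it: everything else there is known to be summable.\<close>
  have "Q i = (s2 - 1) * (R i - D i - E i) + (V i - V (i + N))" for i
  proof -
    have "R i - D i - E i = (Q i - (V i - V (i + N))) / (s2 - 1)"
      unfolding R_eq diff_divide_distrib by simp
    thus ?thesis using assms by simp
  qed
  hence "Q = (\<lambda>i. (s2 - 1) * (R i - D i - E i) + (V i - V (i + N)))" by blast
  hence sQ: "summable Q"
    by (simp only:) (intro summable_add summable_diff[OF summable_diff] summable_mult sums_summable[OF V] sR sD sE)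
  have "R sums (suminf D - (\<Sum>i<N. V i) / (s2 - 1) + suminf Q / (s2 - 1) + suminf E)"
    unfolding R_eq[abs_def]
    by (intro sums_add sums_diff sums_divide V summable_sums sD sQ sE)
  hence "suminf R = suminf D - (\<Sum>i<N. V i) / (s2 - 1) + suminf Q / (s2 - 1) + suminf E"
    by (rule sums_unique[symmetric])
  moreover have "zeta_cont v = (\<Sum>i<N. V i) + of_nat N powr (1 - v) / (v - 1) + em_rem (real N) v"
    unfolding V_def
  proof (rule zeta_cont_eq_partial_sum)
    show "v \<noteq> 1" using assms(4) by (auto simp: v_def diff_eq_eq)
  qed (use assms in \<open>auto simp: v_def\<close>)
  moreover have "D = (\<lambda>i. \<Sum>n = 1..N. 1 / (of_nat (Suc i) powr s1 * of_nat (Suc i + n) powr s2))"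
  proof
    fix i
    have "(\<Sum>n = 1..N. 1 / (of_nat (Suc i) powr s1 * of_nat (Suc i + n) powr s2) :: complex)
        = (\<Sum>j<N. 1 / (of_nat (Suc i) powr s1 * of_nat (Suc i + Suc j) powr s2))"
      by (rule sum.reindex_bij_witness[of _ Suc "\<lambda>n. n - 1"]) auto
    also have "\<dots> = D i"
      unfolding D_def a_def powr_minus by (simp add: field_simps del: of_nat_Suc of_nat_add)
    finally show "D i = (\<Sum>n = 1..N. 1 / (of_nat (Suc i) powr s1 * of_nat (Suc i + n) powr s2))" ..
  qed
  moreover have "double_zeta_cont (s1, s2) = zeta_cont v / (s2 - 1) + suminf R"
    by (simp add: double_zeta_cont_def R_def a_def v_def)
  ultimately show ?thesis
    unfolding E_def Q_def a_def by (simp only: add_divide_distrib) simp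
qed

section \<open>Sizes of the individual pieces\<close>

text \<open>Trades the factor m + N for t. If m \<le> N, then m + N \<le> 2t and the triangle
  inequality is enough (constant 4); if m > N, then m + N \<le> 2m, and the derivative bound for the
  difference supplies N / m (constant 2 |z|).\<close>

lemma norm_of_nat_powr_diff_le:
  fixes m N :: nat and t :: real
  assumes "1 \<le> m" "0 < Re z" "real N \<le> t"
  shows "norm (of_nat m powr (- z) - of_nat (m + N) powr (- z) :: complex) * real (m + N)
    \<le> (4 + 2 * norm z) * t * real m powr (- Re z)"
proof (cases "m \<le> N")
  case True
  have "norm (of_nat m powr (- z) - of_nat (m + N) powr (- z) :: complex)
      \<le> real m powr (- Re z) + real (m + N) powr (- Re z)"
    using assms norm_triangle_ineq4[of "of_nat m powr (- z) :: complex" "of_nat (m + N) powr (- z)"]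
      norm_of_nat_powr[of m "- z"] norm_of_nat_powr[of "m + N" "- z"] by simp
  also have "real (m + N) powr (- Re z) \<le> real m powr (- Re z)"
    using assms by (intro powr_mono2') auto
  finally have "norm (of_nat m powr (- z) - of_nat (m + N) powr (- z) :: complex) \<le> 2 * real m powr (- Re z)"
    by simp
  moreover have "real (m + N) \<le> 2 * t" using True assms by simp
  ultimately have "norm (of_nat m powr (- z) - of_nat (m + N) powr (- z) :: complex) * real (m + N)
      \<le> (2 * real m powr (- Re z)) * (2 * t)"
    by (intro mult_mono) auto
  also have "\<dots> = 4 * (t * real m powr (- Re z))" by simp
  also have "\<dots> \<le> (4 + 2 * norm z) * (t * real m powr (- Re z))"
    using assms by (intro mult_right_mono) auto
  finally show ?thesis by (simp only: mult.assoc)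
next
  case False
  have "norm (complex_of_real (real (m + N)) powr (- z) - complex_of_real (real m) powr (- z))
     \<le> (norm z * real m powr (- Re z - 1)) * (real (m + N) - real m)"
  proof (rule norm_diff_le_of_vector_derivative_bound)
    fix x assume x: "real m \<le> x" "x \<le> real (m + N)"
    show "((\<lambda>x. complex_of_real x powr (- z)) has_vector_derivative (- z * complex_of_real x powr (- z - 1)))
        (at x within {real m..real (m + N)})"
      using x assms by (intro has_vector_derivative_of_real_powr) auto
    have "norm (complex_of_real x powr (- z - 1)) = x powr (- Re z - 1)"
      using x assms by (subst norm_of_real_powr) auto
    also have "\<dots> \<le> real m powr (- Re z - 1)"
      using x assms by (intro powr_mono2') auto
    finally show "norm (- z * complex_of_real x powr (- z - 1)) \<le> norm z * real m powr (- Re z - 1)"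
      unfolding norm_mult norm_minus_cancel by (intro mult_left_mono) auto
  qed auto
  hence "norm (of_nat m powr (- z) - of_nat (m + N) powr (- z) :: complex) \<le> norm z * real m powr (- Re z - 1) * real N"
    by (simp only: of_real_of_nat_eq norm_minus_commute) simp
  also have "\<dots> \<le> norm z * real m powr (- Re z - 1) * t"
    using assms by (intro mult_left_mono) auto
  finally have "norm (of_nat m powr (- z) - of_nat (m + N) powr (- z) :: complex) * real (m + N)
     \<le> (norm z * real m powr (- Re z - 1) * t) * (2 * real m)"
    using False assms by (intro mult_mono) auto
  also have "\<dots> = 2 * norm z * (t * real m powr (- Re z))"
    using assms by (simp add: powr_diff)
  also have "\<dots> \<le> (4 + 2 * norm z) * (t * real m powr (- Re z))"
    using assms by (intro mult_right_mono) auto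
  finally show ?thesis by (simp only: mult.assoc)
qed

lemma sum_real_Suc_powr_le_less_1:
  fixes p :: real
  assumes "0 < p" "p < 1" "1 \<le> N"
  shows "(\<Sum>i<N. real (Suc i) powr (- p)) \<le> real N powr (1 - p) / (1 - p)"
  using assms(3)
proof (induction N rule: nat_induct_at_least)
  case base
  thus ?case using assms by simp
next
  case (Suc n)
  have "\<exists>z. real n < z \<and> z < real n + 1 \<and>
      (real n + 1) powr (1 - p) - real n powr (1 - p) = (real n + 1 - real n) * ((1 - p) * z powr (1 - p - 1))"
    by (rule MVT2) (use Suc in \<open>auto intro!: derivative_eq_intros\<close>)
  then obtain z where z: "real n < z" "z < real n + 1"
      "(real n + 1) powr (1 - p) - real n powr (1 - p) = (1 - p) * z powr (- p)" by auto
  have "(real n + 1) powr (- p) \<le> z powr (- p)"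
    using z Suc assms by (intro powr_mono2') auto
  also have "z powr (- p) = (real n + 1) powr (1 - p) / (1 - p) - real n powr (1 - p) / (1 - p)"
    unfolding diff_divide_distrib [symmetric] z(3) using assms by simp
  finally show ?case using Suc by (simp add: add.commute)
qed

lemma sum_inverse_real_Suc_le:
  assumes "1 \<le> N"
  shows "(\<Sum>i<N. real (Suc i) powr (- 1)) \<le> 1 + ln (real N)"
  using assms
proof (induction N rule: nat_induct_at_least)
  case (Suc n)
  have "ln (real n / (real n + 1)) \<le> real n / (real n + 1) - 1"
    using Suc by (intro ln_le_minus_one) auto
  also have "\<dots> = - (1 / (real n + 1))" by (simp add: field_simps)
  finally have "1 / (real n + 1) \<le> ln (real n + 1) - ln (real n)"
    using Suc by (simp add: ln_div)
  thus ?case using Suc by (simp add: powr_minus_divide add.commute)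
qed simp

definition error_size :: "real \<Rightarrow> real \<Rightarrow> real \<Rightarrow> real" where
  "error_size \<sigma>0 \<sigma> t = (if \<sigma>0 < 1 then t powr (1 - \<sigma>0 - \<sigma>)
     else if \<sigma>0 = 1 then t powr (- \<sigma>) * ln t else t powr (- \<sigma>))"

text \<open>The constant is needed at \<sigma>0 = 1, where ln t may be as small as ln 2; for
  \<sigma>0 > 1 the left side has the smaller exponent.\<close>

lemma powr_le_error_size:
  assumes "0 < \<sigma>0" "2 \<le> t"
  shows "t powr (1 - \<sigma>0 - \<sigma>) \<le> 1 / ln 2 * error_size \<sigma>0 \<sigma> t"
proof -
  have l: "0 < ln (2::real)" "ln 2 < (1::real)" using ln_2_less_1 by auto
  have i: "1 \<le> 1 / ln (2::real)" using l by simp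
  have lt: "ln 2 \<le> ln t" using assms by simp
  consider "\<sigma>0 < 1" | "\<sigma>0 = 1" | "\<sigma>0 > 1" by linarith
  thus ?thesis
  proof cases
    case 1
    thus ?thesis using mult_right_mono[OF i, of "t powr (1 - \<sigma>0 - \<sigma>)"] by (simp add: error_size_def)
  next
    case 2
    have "t powr (- \<sigma>) * 1 \<le> t powr (- \<sigma>) * (ln t / ln 2)"
      using lt l by (intro mult_left_mono) auto
    thus ?thesis using 2 by (simp add: error_size_def)
  next
    case 3
    have "1 * t powr (1 - \<sigma>0 - \<sigma>) \<le> 1 / ln 2 * t powr (- \<sigma>)"
      using 3 assms i by (intro mult_mono powr_mono) auto
    thus ?thesis using 3 by (simp add: error_size_def)
  qed
qed

lemma error_size_bounds:
  assumes "0 < \<sigma>0" "0 < \<sigma>" "1 < \<sigma>0 + \<sigma>"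
  obtains K where "0 \<le> K"
    and "\<And>t N. 2 \<le> t \<Longrightarrow> N = nat \<lfloor>t\<rfloor> \<Longrightarrow> real N powr (1 - \<sigma>0 - \<sigma>) \<le> K * error_size \<sigma>0 \<sigma> t"
    and "\<And>t N. 2 \<le> t \<Longrightarrow> N = nat \<lfloor>t\<rfloor> \<Longrightarrow>
           real N powr (- \<sigma>) * (\<Sum>i<N. real (Suc i) powr (- \<sigma>0)) \<le> K * error_size \<sigma>0 \<sigma> t"
proof -
  \<comment> \<open>The powers of 2 in \<open>K1\<close> and \<open>K2\<close> come from N \<ge> t /
    2, valid for t \<ge> 2. The three cases of \<open>K2\<close> bound the sum of
    \<open>k powr (- \<sigma>0)\<close> over k \<le> N, relative to t^(1 - \<sigma>0), ln t and 1;
    for \<sigma>0 = 1 the term 1 / ln 2 absorbs the 1 in 1 + ln N.\<close>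
  define K1 where "K1 = 2 powr (\<sigma>0 + \<sigma> - 1) / ln 2"
  define K2 where "K2 = 2 powr \<sigma> * (if \<sigma>0 < 1 then 1 / (1 - \<sigma>0) else if \<sigma>0 = 1 then 1 / ln 2 + 1 else 1 + 1 / (\<sigma>0 - 1))"
  have K: "0 \<le> K1" "0 \<le> K2" by (auto simp: K1_def K2_def)
  have half: "real N powr (- p) \<le> 2 powr p * t powr (- p)" if "0 < p" "2 \<le> t" "N = nat \<lfloor>t\<rfloor>" for p t N
  proof -
    have "real N powr (- p) \<le> (t / 2) powr (- p)"
    proof (rule powr_mono2')
      show "t / 2 \<le> real N" using that by linarith
    qed (use that in auto)
    also have "\<dots> = 2 powr p * t powr (- p)"
      using that by (simp add: powr_divide powr_minus field_simps)
    finally show ?thesis .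
  qed
  have es: "0 \<le> error_size \<sigma>0 \<sigma> t" if "2 \<le> t" for t
    using that by (auto simp: error_size_def)
  show ?thesis
  proof (rule that[of "K1 + K2"])
    show "0 \<le> K1 + K2" using K by simp
    fix t :: real and N :: nat assume t: "2 \<le> t" "N = nat \<lfloor>t\<rfloor>"
    have N: "1 \<le> N" "real N \<le> t" using t by linarith+
    have "real N powr (1 - \<sigma>0 - \<sigma>) \<le> 2 powr (\<sigma>0 + \<sigma> - 1) * t powr (1 - \<sigma>0 - \<sigma>)"
      using half[of "\<sigma>0 + \<sigma> - 1" t N] assms t by (simp add: algebra_simps)
    also have "\<dots> \<le> 2 powr (\<sigma>0 + \<sigma> - 1) * (1 / ln 2 * error_size \<sigma>0 \<sigma> t)"
      using assms t by (intro mult_left_mono powr_le_error_size) auto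
    also have "\<dots> = K1 * error_size \<sigma>0 \<sigma> t" by (simp add: K1_def)
    also have "\<dots> \<le> (K1 + K2) * error_size \<sigma>0 \<sigma> t"
      using K es t by (intro mult_right_mono) auto
    finally show "real N powr (1 - \<sigma>0 - \<sigma>) \<le> (K1 + K2) * error_size \<sigma>0 \<sigma> t" .
    have n: "real N powr (- \<sigma>) \<le> 2 powr \<sigma> * t powr (- \<sigma>)"
      using half[of \<sigma> t N] assms t by simp
    define H where "H = (\<Sum>i<N. real (Suc i) powr (- \<sigma>0))"
    have H0: "0 \<le> H" unfolding H_def by (intro sum_nonneg) auto
    have "real N powr (- \<sigma>) * H \<le> K2 * error_size \<sigma>0 \<sigma> t"
    proof -
      consider "\<sigma>0 < 1" | "\<sigma>0 = 1" | "\<sigma>0 > 1" by linarith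
      thus ?thesis
      proof cases
        case 1
        have "H \<le> real N powr (1 - \<sigma>0) / (1 - \<sigma>0)"
          unfolding H_def using 1 assms N by (intro sum_real_Suc_powr_le_less_1) auto
        also have "\<dots> \<le> t powr (1 - \<sigma>0) / (1 - \<sigma>0)"
          using 1 N t by (intro divide_right_mono powr_mono2) auto
        finally have "real N powr (- \<sigma>) * H \<le> (2 powr \<sigma> * t powr (- \<sigma>)) * (t powr (1 - \<sigma>0) / (1 - \<sigma>0))"
          using n H0 by (intro mult_mono) auto
        also have "\<dots> = 2 powr \<sigma> * (1 / (1 - \<sigma>0)) * (t powr (- \<sigma>) * t powr (1 - \<sigma>0))" by simp
        also have "t powr (- \<sigma>) * t powr (1 - \<sigma>0) = t powr (1 - \<sigma>0 - \<sigma>)"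
          unfolding powr_add [symmetric] by (simp add: algebra_simps)
        finally show ?thesis using 1 by (simp add: K2_def error_size_def)
      next
        case 2
        have l: "0 < ln (2::real)" "ln 2 \<le> ln t" using t by auto
        have "H \<le> 1 + ln (real N)"
          unfolding H_def 2 using N by (intro sum_inverse_real_Suc_le)
        also have "\<dots> \<le> ln t / ln 2 + ln t" using l N t by (intro add_mono) auto
        also have "\<dots> = (1 / ln 2 + 1) * ln t" by (simp add: algebra_simps)
        finally have "real N powr (- \<sigma>) * H \<le> (2 powr \<sigma> * t powr (- \<sigma>)) * ((1 / ln 2 + 1) * ln t)"
          using n H0 by (intro mult_mono) auto
        thus ?thesis using 2 by (simp add: K2_def error_size_def mult_ac)
      next
        case 3
        have sm: "summable (\<lambda>j. (1 + real j) powr (- (\<sigma>0 - 1) - 1))"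
          using 3 by (intro summable_powr_shift) auto
        have "H = (\<Sum>j<N. (1 + real j) powr (- (\<sigma>0 - 1) - 1))" by (simp add: H_def)
        also have "\<dots> \<le> (\<Sum>j. (1 + real j) powr (- (\<sigma>0 - 1) - 1))"
          by (rule sum_le_suminf[OF sm]) auto
        also have "\<dots> \<le> 1 + 1 / (\<sigma>0 - 1)"
          using suminf_powr_shift_le[of 1 "\<sigma>0 - 1"] 3 by simp
        finally have "real N powr (- \<sigma>) * H \<le> (2 powr \<sigma> * t powr (- \<sigma>)) * (1 + 1 / (\<sigma>0 - 1))"
          using n H0 by (intro mult_mono) auto
        thus ?thesis using 3 by (simp add: K2_def error_size_def mult_ac)
      qed
    qed
    also have "\<dots> \<le> (K1 + K2) * error_size \<sigma>0 \<sigma> t"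
      using K es t by (intro mult_right_mono) auto
    finally show "real N powr (- \<sigma>) * (\<Sum>i<N. real (Suc i) powr (- \<sigma>0)) \<le> (K1 + K2) * error_size \<sigma>0 \<sigma> t"
      by (simp only: H_def)
  qed
qed

lemma summable_powr_product:
  fixes \<sigma>0 \<sigma> :: real
  assumes "0 < \<sigma>" "1 < \<sigma>0 + \<sigma>"
  shows "summable (\<lambda>i. real (Suc i) powr (- \<sigma>0) * real (Suc i + N) powr (- \<sigma>))"
proof (rule summable_comparison_test'[OF summable_real_Suc_powr[OF assms(2)]])
  fix i
  have "real (Suc i) powr (- \<sigma>0) * real (Suc i + N) powr (- \<sigma>) \<le> real (Suc i) powr (- \<sigma>0) * real (Suc i) powr (- \<sigma>)"
    using assms by (intro mult_left_mono powr_mono2') auto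
  also have "\<dots> = real (Suc i) powr (- (\<sigma>0 + \<sigma>))" unfolding powr_add [symmetric] by simp
  finally show "norm (real (Suc i) powr (- \<sigma>0) * real (Suc i + N) powr (- \<sigma>)) \<le> real (Suc i) powr (- (\<sigma>0 + \<sigma>))"
    by simp
qed

text \<open>The series that majorises both \<open>E\<close> and \<open>Q\<close>, split at i = N:
  before, the second factor is at most \<open>real N powr (- \<sigma>)\<close>; after, it is at most
  the same power of the smaller base \<open>Suc i\<close>, which leaves a tail of exponent \<sigma>0
  + \<sigma> > 1.\<close>

lemma suminf_powr_product_le:
  fixes \<sigma>0 \<sigma> :: real
  assumes "0 < \<sigma>0" "0 < \<sigma>" "1 < \<sigma>0 + \<sigma>" "1 \<le> N"
  shows "(\<Sum>i. real (Suc i) powr (- \<sigma>0) * real (Suc i + N) powr (- \<sigma>))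
     \<le> real N powr (- \<sigma>) * (\<Sum>i<N. real (Suc i) powr (- \<sigma>0)) + real N powr (1 - \<sigma>0 - \<sigma>) / (\<sigma>0 + \<sigma> - 1)"
proof -
  define f where "f = (\<lambda>i. real (Suc i) powr (- \<sigma>0) * real (Suc i + N) powr (- \<sigma>))"
  define q where "q = \<sigma>0 + \<sigma> - 1"
  have q: "0 < q" using assms by (simp add: q_def)
  have sf: "summable f" unfolding f_def using assms by (intro summable_powr_product)
  have "suminf f = (\<Sum>i. f (i + N)) + (\<Sum>i<N. f i)"
    by (rule suminf_split_initial_segment[OF sf])
  moreover have "(\<Sum>i<N. f i) \<le> (\<Sum>i<N. real N powr (- \<sigma>) * real (Suc i) powr (- \<sigma>0))"
  proof (rule sum_mono)
    fix i
    have "real (Suc i + N) powr (- \<sigma>) \<le> real N powr (- \<sigma>)"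
      using assms by (intro powr_mono2') auto
    hence "real (Suc i) powr (- \<sigma>0) * real (Suc i + N) powr (- \<sigma>) \<le> real (Suc i) powr (- \<sigma>0) * real N powr (- \<sigma>)"
      by (rule mult_left_mono) auto
    thus "f i \<le> real N powr (- \<sigma>) * real (Suc i) powr (- \<sigma>0)"
      unfolding f_def by (simp only: mult.commute)
  qed
  moreover have "(\<Sum>i. f (i + N)) \<le> real N powr (- q) / q"
  proof (rule suminf_le_const)
    show "summable (\<lambda>i. f (i + N))" by (rule summable_ignore_initial_segment[OF sf])
    fix n
    have "(\<Sum>i<n. f (i + N)) \<le> (\<Sum>i<n. (real N + real (Suc i)) powr (- q - 1))"
    proof (rule sum_mono)
      fix i
      have "f (i + N) \<le> real (Suc (i + N)) powr (- \<sigma>0) * real (Suc (i + N)) powr (- \<sigma>)"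
        unfolding f_def using assms by (intro mult_left_mono powr_mono2') auto
      also have "\<dots> = (real N + real (Suc i)) powr (- q - 1)"
        unfolding powr_add [symmetric] by (simp add: q_def algebra_simps)
      finally show "f (i + N) \<le> (real N + real (Suc i)) powr (- q - 1)" .
    qed
    also have "\<dots> \<le> real N powr (- q) / q"
      using assms q by (intro sum_powr_shift_le) auto
    finally show "(\<Sum>i<n. f (i + N)) \<le> real N powr (- q) / q" .
  qed
  moreover have "real N powr (- q) / q = real N powr (1 - \<sigma>0 - \<sigma>) / q" by (simp add: q_def algebra_simps)
  ultimately have "suminf f \<le> real N powr (- \<sigma>) * (\<Sum>i<N. real (Suc i) powr (- \<sigma>0)) + real N powr (1 - \<sigma>0 - \<sigma>) / q"
    unfolding sum_distrib_left by linarith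
  thus ?thesis unfolding f_def q_def .
qed

text \<open>The constant is to serve all t at once, so s must keep a distance from the pole at s0 +
  s = 2: if \<sigma>0 + \<sigma> = 2 and Im s0 \<le> -2, the value t = - Im s0 hits it. Hence the
  parameter \<open>\<delta>\<close>, on which C may depend besides s0 and \<sigma>.\<close>

theorem theorem6p3:
  fixes s0 :: complex and \<sigma> \<delta> :: real
  assumes "0 < Re s0" and "Re s0 < 3/2"
    and "\<sigma> > 1/2" and "Re s0 + \<sigma> > 1"
    and "\<delta> > 0"
  shows "\<exists>C. \<forall>s t. s = Complex \<sigma> t \<and> t \<ge> 2 \<and> s \<noteq> 1 \<and> s0 + s \<noteq> 2 \<and> norm (s0 + s - 2) \<ge> \<delta> \<longrightarrow>
           norm (double_zeta s0 s -
             (\<Sum>i. \<Sum>n = 1..nat \<lfloor>t\<rfloor>.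
                1 / (of_nat (Suc i) powr s0 * of_nat (Suc i + n) powr s)))
           \<le> C * (if Re s0 < 1 then t powr (1 - Re s0 - \<sigma>)
                  else if Re s0 = 1 then t powr (- \<sigma>) * ln t
                  else t powr (- \<sigma>))"
proof -
  define \<sigma>0 where "\<sigma>0 = Re s0"
  define q where "q = \<sigma>0 + \<sigma> - 1"
  have \<sigma>: "0 < \<sigma>" "0 < \<sigma>0" "1 < \<sigma>0 + \<sigma>" and q: "0 < q"
    using assms by (auto simp: \<sigma>0_def q_def)
  obtain A where A: "0 \<le> A" "\<And>t x s. Re s = \<sigma> \<Longrightarrow> Im s = t \<Longrightarrow> 1 \<le> t \<Longrightarrow> t \<le> x \<Longrightarrow>
     norm (em_rem x s) \<le> A * x powr (- \<sigma>)"
    using norm_em_rem_le_uniform[OF \<sigma>(1)] by blast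
  obtain K where K: "0 \<le> K"
    "\<And>t N. 2 \<le> t \<Longrightarrow> N = nat \<lfloor>t\<rfloor> \<Longrightarrow> real N powr (1 - \<sigma>0 - \<sigma>) \<le> K * error_size \<sigma>0 \<sigma> t"
    "\<And>t N. 2 \<le> t \<Longrightarrow> N = nat \<lfloor>t\<rfloor> \<Longrightarrow>
           real N powr (- \<sigma>) * (\<Sum>i<N. real (Suc i) powr (- \<sigma>0)) \<le> K * error_size \<sigma>0 \<sigma> t"
    using error_size_bounds[OF \<sigma>(2,1,3)] by blast
  define B where "B = 4 + 2 * norm s0"
  define c where "c = (norm s0 + 1) * (1 + 1 / q)"
  have B: "0 \<le> B" by (simp add: B_def)
  have c: "0 \<le> c" using q by (simp add: c_def)
  \<comment> \<open>\<open>A\<close> and \<open>B\<close> belong to \<open>E\<close> and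
    \<open>Q\<close>, each bounded through the sum of \<open>P\<close>; 1 / \<delta> to the pole
    term, \<open>c\<close> to the remainder at v.\<close>
  define C where "C = (A + B) * (K + K / q) + (1 / \<delta> + c) * K"
  show ?thesis
  proof (rule exI[of _ C], intro allI impI)
    fix s :: complex and t :: real
    assume H: "s = Complex \<sigma> t \<and> t \<ge> 2 \<and> s \<noteq> 1 \<and> s0 + s \<noteq> 2 \<and> norm (s0 + s - 2) \<ge> \<delta>"
    hence s: "Re s = \<sigma>" "Im s = t" "s \<noteq> 1" "s0 + s \<noteq> 2" "norm (s0 + s - 2) \<ge> \<delta>" and t: "2 \<le> t"
      by auto
    define N where "N = nat \<lfloor>t\<rfloor>"
    have N: "1 \<le> N" "real N \<le> t" "t \<le> real N + 1" using t unfolding N_def by linarith+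
    define v where "v = s0 + s - 1"
    have v: "Re v = q" "v \<noteq> 1" using s(4) by (auto simp: v_def q_def \<sigma>0_def s diff_eq_eq)
    define e where "e = error_size \<sigma>0 \<sigma> t"
    define P where "P = (\<lambda>i. real (Suc i) powr (- \<sigma>0) * real (Suc i + N) powr (- \<sigma>))"
    have sP: "summable P" unfolding P_def using \<sigma> by (intro summable_powr_product)
    \<comment> \<open>Every factor of size t lost in \<open>Q_le\<close>, \<open>M_le\<close> and
      \<open>R_le\<close> is paid for by this.\<close>
    have s1: "t \<le> norm (s - 1)"
      using abs_Im_le_cmod[of "s - 1"] s t by simp
    have s1': "0 < norm (s - 1)" using s1 t by linarith
    define E where "E = (\<lambda>i. of_nat (Suc i) powr (- s0) * em_rem (real (Suc i + N)) s)"
    define Q :: "nat \<Rightarrow> complex" where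
      "Q = (\<lambda>i. (of_nat (Suc i) powr (- s0) - of_nat (Suc i + N) powr (- s0)) * of_nat (Suc i + N) powr (1 - s))"
    have Nq: "real N powr (- q) \<le> K * e"
      using K(2)[OF t N_def] by (simp add: q_def e_def algebra_simps)
    hence Ke: "0 \<le> K * e" by (rule order_trans[OF powr_ge_zero])
    have P_le: "suminf P \<le> (K + K / q) * e"
    proof -
      have "suminf P \<le> real N powr (- \<sigma>) * (\<Sum>i<N. real (Suc i) powr (- \<sigma>0)) + real N powr (1 - \<sigma>0 - \<sigma>) / (\<sigma>0 + \<sigma> - 1)"
        unfolding P_def using \<sigma> N by (intro suminf_powr_product_le)
      also have "\<dots> \<le> K * e + K * e / q"
        unfolding e_def q_def using K(2,3)[OF t N_def] \<sigma> by (intro add_mono divide_right_mono) auto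
      finally show ?thesis by (simp add: algebra_simps)
    qed
    have E_le: "norm (suminf E) \<le> A * suminf P"
    proof -
      have "norm (E i) \<le> A * P i" for i
      proof -
        have "norm (E i) = real (Suc i) powr (- \<sigma>0) * norm (em_rem (real (Suc i + N)) s)"
          unfolding E_def norm_mult norm_of_nat_powr[OF zero_less_Suc] by (simp add: \<sigma>0_def)
        \<comment> \<open>The uniform bound needs an argument of at least t. N may fall short of it,
          but Suc i + N \<ge> N + 1 \<ge> t.\<close>
        also have "\<dots> \<le> real (Suc i) powr (- \<sigma>0) * (A * real (Suc i + N) powr (- \<sigma>))"
          using s t N by (intro mult_left_mono A(2)[of s t]) auto
        finally show ?thesis by (simp only: P_def mult_ac)
      qed
      hence "norm (suminf E) \<le> (\<Sum>i. A * P i)"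
        by (intro norm_suminf_le summable_mult sP)
      thus ?thesis by (simp only: suminf_mult[OF sP])
    qed
    have Q_le: "norm (suminf Q / (s - 1)) \<le> B * suminf P"
    proof -
      have "norm (Q i) \<le> (B * norm (s - 1)) * P i" for i
      proof -
        let ?d = "norm (of_nat (Suc i) powr (- s0) - of_nat (Suc i + N) powr (- s0) :: complex)"
        have "norm (Q i) = ?d * real (Suc i + N) powr (1 - \<sigma>)"
          unfolding Q_def norm_mult using norm_of_nat_powr[of "Suc i + N" "1 - s"] s by simp
        also have "real (Suc i + N) powr (1 - \<sigma>) = real (Suc i + N) * real (Suc i + N) powr (- \<sigma>)"
          by (simp add: powr_diff powr_minus field_simps)
        also have "?d * (real (Suc i + N) * real (Suc i + N) powr (- \<sigma>))
            = (?d * real (Suc i + N)) * real (Suc i + N) powr (- \<sigma>)" by simp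
        also have "\<dots> \<le> (B * t * real (Suc i) powr (- \<sigma>0)) * real (Suc i + N) powr (- \<sigma>)"
          unfolding B_def \<sigma>0_def using N \<sigma>
          by (intro mult_right_mono norm_of_nat_powr_diff_le) (auto simp: \<sigma>0_def)
        also have "\<dots> = (B * t) * P i" by (simp add: P_def)
        also have "\<dots> \<le> (B * norm (s - 1)) * P i"
          using B s1 by (intro mult_right_mono mult_left_mono) (auto simp: P_def)
        finally show ?thesis .
      qed
      hence "norm (suminf Q) \<le> (\<Sum>i. (B * norm (s - 1)) * P i)"
        by (intro norm_suminf_le summable_mult sP)
      hence "norm (suminf Q) \<le> (B * norm (s - 1)) * suminf P"
        by (simp only: suminf_mult[OF sP])
      thus ?thesis using s1' by (simp add: norm_divide field_simps)
    qed
    have M_le: "norm (of_nat N powr (1 - v) / (v - 1) / (s - 1)) \<le> 1 / \<delta> * (K * e)"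
    proof -
      have "norm (of_nat N powr (1 - v) / (v - 1) / (s - 1)) = real N powr (1 - q) / norm (v - 1) / norm (s - 1)"
        using N v norm_of_nat_powr[of N "1 - v"] by (simp add: norm_divide norm_mult)
      also have "real N powr (1 - q) = real N * real N powr (- q)"
        using N by (simp add: powr_diff powr_minus field_simps)
      \<comment> \<open>The surplus factor N is at most |s - 1|, and v - 1 = s0 + s - 2 is at least
        \<open>\<delta>\<close> in modulus.\<close>
      also have "real N * real N powr (- q) / norm (v - 1) / norm (s - 1) \<le> norm (s - 1) * (K * e) / \<delta> / norm (s - 1)"
      proof (intro divide_right_mono frac_le mult_mono)
        show "\<delta> \<le> norm (v - 1)" using s(5) by (simp add: v_def algebra_simps)
        show "real N \<le> norm (s - 1)" using N s1 by linarith
      qed (use Nq Ke assms in \<open>auto intro!: mult_nonneg_nonneg[OF norm_ge_zero]\<close>)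
      also have "\<dots> = 1 / \<delta> * (K * e)" using s1' by simp
      finally show ?thesis .
    qed
    have R_le: "norm (em_rem (real N) v / (s - 1)) \<le> c * (K * e)"
    proof -
      have "norm v \<le> norm s0 + norm (s - 1)"
        unfolding v_def using norm_triangle_ineq[of s0 "s - 1"] by (simp add: algebra_simps)
      also have "\<dots> \<le> norm s0 * norm (s - 1) + norm (s - 1)"
        using s1 t mult_left_mono[of 1 "norm (s - 1)" "norm s0"] by simp
      finally have nv: "norm v \<le> (norm s0 + 1) * norm (s - 1)" by (simp add: algebra_simps)
      \<comment> \<open>The termwise bound suffices here: its factor |v| is at most (|s0| + 1) |s -
        1|, and the division by s - 1 removes it.\<close>
      have "norm (em_rem (real N) v) \<le> norm v * (1 + 1 / q) * real N powr (- q)"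
        using norm_em_rem_le[of "real N" v] v N q by simp
      also have "\<dots> \<le> ((norm s0 + 1) * norm (s - 1)) * (1 + 1 / q) * (K * e)"
        using nv q Nq by (intro mult_mono) auto
      also have "\<dots> = c * (K * e) * norm (s - 1)" by (simp add: c_def)
      finally show ?thesis using s1' by (simp add: norm_divide field_simps)
    qed
    have "double_zeta s0 s = double_zeta_cont (s0, s)"
      using s \<sigma> by (intro double_zeta_eq_cont) (auto simp: \<sigma>0_def)
    hence eq: "double_zeta s0 s - (\<Sum>i. \<Sum>n = 1..N. 1 / (of_nat (Suc i) powr s0 * of_nat (Suc i + n) powr s))
       = suminf E + (of_nat N powr (1 - v) / (v - 1) / (s - 1) + em_rem (real N) v / (s - 1) + suminf Q / (s - 1))"
      using double_zeta_cont_minus_partial[of s s0 N] s \<sigma> N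
      unfolding E_def Q_def v_def add_divide_distrib by (simp add: \<sigma>0_def)
    have "norm (double_zeta s0 s - (\<Sum>i. \<Sum>n = 1..N. 1 / (of_nat (Suc i) powr s0 * of_nat (Suc i + n) powr s)))
       \<le> A * suminf P + (1 / \<delta> * (K * e) + c * (K * e) + B * suminf P)"
      unfolding eq by (intro norm_triangle_mono E_le M_le R_le Q_le)
    also have "\<dots> = (A + B) * suminf P + (1 / \<delta> + c) * (K * e)" by (simp add: algebra_simps)
    also have "\<dots> \<le> (A + B) * ((K + K / q) * e) + (1 / \<delta> + c) * (K * e)"
      using A B P_le by (intro add_right_mono mult_left_mono) auto
    also have "\<dots> = C * e" unfolding C_def by (simp only: distrib_right [of _ _ e] mult.assoc)
    finally show "norm (double_zeta s0 s -
             (\<Sum>i. \<Sum>n = 1..nat \<lfloor>t\<rfloor>.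
                1 / (of_nat (Suc i) powr s0 * of_nat (Suc i + n) powr s)))
           \<le> C * (if Re s0 < 1 then t powr (1 - Re s0 - \<sigma>)
                  else if Re s0 = 1 then t powr (- \<sigma>) * ln t
                  else t powr (- \<sigma>))"
      unfolding N_def e_def error_size_def \<sigma>0_def .
  qed
qed

end
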